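(* Let $n\in\omega$ and let $\mathcal{G}$ be a countable family of analytic hypergraphs on a Polish space $X$ such that each hypergraph in $\mathcal{G}$ has arity $\leq n$. If the poset $P_{I_{\mathcal{G}}}$ is proper, then it has the $n$-localization property.
   Context: For a Polish space $X$, $X^{\leq\omega}$ denotes the space of all finite sequences and all $\omega$-sequences of elements of $X$. A hypergraph on $X$ is a set $G\subset X^{\leq\omega}$; its elements are called edges. $G$ is analytic if it is an analytic subset of $X^{\leq\omega}$; it has arity $\leq n$ if each of its edges is a sequence of length at most $n$. A $G$-anticlique is a set $B\subset X$ with $B^{\leq\omega}\cap G=\emptyset$. For a countable collection $\mathcal{G}$ of hypergraphs on $X$, $I_{\mathcal{G}}$ is the $\sigma$-ideal on $X$ $\sigma$-generated by the Borel sets which are anticliques in at least one of the hypergraphs in $\mathcal{G}$. For a $\sigma$-ideal $I$, $P_I$ is the poset of Borel subsets of $X$ not in $I$, ordered by inclusion. For a natural number $m$, a poset $P$ has the $m$-localization property if every element of $\omega^\omega$ in the $P$-extension is a branch through some tree $T\subset\omega^{<\omega}$ in the ground model which is $\leq m$-branching (every node of $T$ has at most $m$ immediate successors in $T$).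
   Formalization: The case n = 0 is excluded (n ≥ 1 is assumed): for X a point and the family empty, or with its only hypergraph having the empty sequence as sole edge, the poset is {X}, which is proper but lacks the 0-localization property. *)

theory Defs
  imports "HOL-Analysis.Analysis" "HOL-Library.Extended_Nat" "HOL-Library.Sublist"
begin

section \<open>Hypergraphs on a Polish space and their ideals\<close>

text \<open>An element of $X^{\le\omega}$ is a pair \<open>(l, s)\<close> of a length \<open>l \<le> \<infinity>\<close> and a function \<open>s\<close>
  on \<open>{i. enat i < l}\<close> (extensional, that is, \<open>undefined\<close> at the other indices). The empty sequence
  is included.\<close>

type_synonym 'a hypergraph = "(enat \<times> (nat \<Rightarrow> 'a)) set"

definition seqs :: "'a set \<Rightarrow> (enat \<times> (nat \<Rightarrow> 'a)) set" where
  "seqs B = (SIGMA l:UNIV. {i. enat i < l} \<rightarrow>\<^sub>E B)"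

definition seq_space :: "(enat \<times> (nat \<Rightarrow> 'a::topological_space)) topology" where
  "seq_space = sum_topology (\<lambda>l. product_topology (\<lambda>_. euclidean) {i. enat i < l}) UNIV"

lemma topspace_seq_space: "topspace seq_space = seqs UNIV"
  by (simp add: seq_space_def seqs_def comp_def)

definition analytic_in :: "'b topology \<Rightarrow> 'b set \<Rightarrow> bool" where
  "analytic_in T A \<longleftrightarrow>
     A = {} \<or> (\<exists>f. continuous_map (euclidean :: (nat \<Rightarrow> nat) topology) T f \<and> A = range f)"

lemma analytic_in_subset: "analytic_in T A \<Longrightarrow> A \<subseteq> topspace T"
  by (auto simp: analytic_in_def continuous_map_def)

definition arity_le :: "nat \<Rightarrow> 'a hypergraph \<Rightarrow> bool" where
  "arity_le n G \<longleftrightarrow> (\<forall>(l, s) \<in> G. l \<le> enat n)"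

definition anticlique :: "'a hypergraph \<Rightarrow> 'a set \<Rightarrow> bool" where
  "anticlique G B \<longleftrightarrow> seqs B \<inter> G = {}"

definition sigma_ideal_generated :: "'a set set \<Rightarrow> 'a set set" where
  "sigma_ideal_generated \<S> = {A. \<exists>\<C> \<subseteq> \<S>. countable \<C> \<and> A \<subseteq> \<Union>\<C>}"

definition hypergraph_ideal :: "'a::topological_space hypergraph set \<Rightarrow> 'a set set" where
  "hypergraph_ideal \<G> = sigma_ideal_generated {B \<in> sets borel. \<exists>G\<in>\<G>. anticlique G B}"

definition positive_borel :: "'a::topological_space set set \<Rightarrow> 'a set set" where
  "positive_borel I = sets borel - I"


section \<open>The structure \<open>H\<^sub>\<theta>\<close>\<close>

text \<open>The type \<open>'p hset\<close> is the set $H_\theta$ for $\theta = (2^{|'p|+\aleph_0})^+$, built over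
  urelements \<open>hatom p\<close> for \<open>p :: 'p\<close>. It arises from well-founded trees in which each node has at
  most $2^{|'p|+\aleph_0}$ children, by identifying trees that have the same members.\<close>

datatype 'p pre_hset = Atom 'p | Coll "('p + nat) set \<Rightarrow> 'p pre_hset option"

inductive heq :: "'p pre_hset \<Rightarrow> 'p pre_hset \<Rightarrow> bool" where
  heq_Atom: "heq (Atom p) (Atom p)"
| heq_Coll: "\<lbrakk>\<forall>x\<in>ran f. \<exists>y\<in>ran g. heq x y; \<forall>y\<in>ran g. \<exists>x\<in>ran f. heq x y\<rbrakk>
    \<Longrightarrow> heq (Coll f) (Coll g)"

lemma heq_refl: "heq x x"
proof (induction x)
  case (Atom p)
  show ?case by (rule heq_Atom)
next
  case (Coll f)
  have "heq y y" if "y \<in> ran f" for y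
    using that Coll[of "Some y" y] by (auto simp: ran_def) (metis rangeI)
  then show ?case by (intro heq_Coll) auto
qed

lemma heq_sym: "heq x y \<Longrightarrow> heq y x"
proof (induction rule: heq.induct)
  case (heq_Atom p)
  show ?case by (rule heq.heq_Atom)
next
  case (heq_Coll f g)
  then show ?case by (intro heq.heq_Coll) blast+
qed

lemma heq_trans: "heq x y \<Longrightarrow> heq y z \<Longrightarrow> heq x z"
proof (induction arbitrary: z rule: heq.induct)
  case (heq_Atom p)
  then show ?case by simp
next
  case (heq_Coll f g)
  from heq_Coll.prems obtain h where h: "z = Coll h"
      "\<forall>x\<in>ran g. \<exists>y\<in>ran h. heq x y" "\<forall>y\<in>ran h. \<exists>x\<in>ran g. heq x y"
    by (cases rule: heq.cases) auto
  show ?case unfolding h(1)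
    by (intro heq.heq_Coll) (use heq_Coll.IH h(2,3) in \<open>blast+\<close>)
qed

lemma equivp_heq: "equivp heq"
  by (intro equivpI reflpI sympI transpI) (blast intro: heq_refl heq_sym heq_trans)+

quotient_type 'p hset = "'p pre_hset" / heq
  by (rule equivp_heq)

lift_definition hatom :: "'p \<Rightarrow> 'p hset" is Atom .

lift_definition hmem :: "'p hset \<Rightarrow> 'p hset \<Rightarrow> bool" is
  "\<lambda>x y. case y of Atom p \<Rightarrow> False | Coll f \<Rightarrow> \<exists>z\<in>ran f. heq x z"
proof -
  fix x x' y y' :: "'p pre_hset"
  assume x: "heq x x'" and y: "heq y y'"
  from y show "(case y of Atom p \<Rightarrow> False | Coll f \<Rightarrow> \<exists>z\<in>ran f. heq x z) =
      (case y' of Atom p \<Rightarrow> False | Coll f \<Rightarrow> \<exists>z\<in>ran f. heq x' z)"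
  proof (cases rule: heq.cases)
    case (heq_Atom p)
    then show ?thesis by simp
  next
    case (heq_Coll f g)
    then show ?thesis
      by simp (meson x heq_sym heq_trans)
  qed
qed

lemma hset_extensionality:
  assumes a: "a \<notin> range hatom" and b: "b \<notin> range hatom"
    and ab: "\<And>x. hmem x a \<longleftrightarrow> hmem x b"
  shows "a = b"
proof -
  have coll: "\<exists>f. c = abs_hset (Coll f)" if "c \<notin> range hatom" for c :: "'p hset"
  proof -
    obtain y where "c = abs_hset y"
      by (metis Quotient3_abs_rep Quotient3_hset)
    then show ?thesis using that by (cases y) (auto simp: hatom.abs_eq)
  qed
  obtain f g where f: "a = abs_hset (Coll f)" and g: "b = abs_hset (Coll g)"
    using coll[OF a] coll[OF b] by auto
  have *: "(\<exists>z\<in>ran f. heq x z) \<longleftrightarrow> (\<exists>z\<in>ran g. heq x z)" for x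
    using ab[of "abs_hset x"] by (simp add: f g hmem.abs_eq)
  have "heq (Coll f) (Coll g)"
    by (rule heq_Coll) (use * heq_refl heq_sym in \<open>blast+\<close>)
  then show ?thesis by (simp add: f g hset.abs_eq_iff)
qed

text \<open>The set with the given elements; it exists for families of size at most
  $2^{|'p|+\aleph_0}$.\<close>

definition hcollect :: "'p hset set \<Rightarrow> 'p hset" where
  "hcollect A = (THE a. a \<notin> range hatom \<and> (\<forall>x. hmem x a \<longleftrightarrow> x \<in> A))"

lemma hcollect:
  fixes A :: "'p hset set" and h :: "('p + nat) set \<Rightarrow> 'p hset"
  assumes "A \<subseteq> range h"
  shows "hcollect A \<notin> range hatom" "hmem x (hcollect A) \<longleftrightarrow> x \<in> A"
proof -
  define f where "f u = (if h u \<in> A then Some (rep_hset (h u)) else None)" for u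
  let ?a = "abs_hset (Coll f)"
  have 1: "?a \<notin> range hatom"
    by (auto simp: hatom.abs_eq hset.abs_eq_iff elim: heq.cases)
  have ran_f: "ran f = rep_hset ` A"
    using assms by (auto simp: ran_def f_def split: if_splits)
  have 2: "hmem x ?a \<longleftrightarrow> x \<in> A" for x
  proof -
    obtain y where y: "x = abs_hset y"
      by (metis Quotient3_abs_rep Quotient3_hset)
    have "heq y (rep_hset z) \<longleftrightarrow> abs_hset y = z" for z
      by (metis Quotient3_abs_rep Quotient3_hset hset.abs_eq_iff)
    then show ?thesis by (auto simp: y hmem.abs_eq ran_f)
  qed
  have "hcollect A = ?a"
    unfolding hcollect_def
    by (rule the_equality) (use 1 2 in \<open>auto intro: hset_extensionality\<close>)
  with 1 2 show "hcollect A \<notin> range hatom" "hmem x (hcollect A) \<longleftrightarrow> x \<in> A" by auto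
qed

definition hpair :: "'p hset \<Rightarrow> 'p hset \<Rightarrow> 'p hset" where
  "hpair x y = hcollect {hcollect {x}, hcollect {x, y}}"


section \<open>Elementary submodels\<close>

datatype fm = FAtom nat | FEq nat nat | FMem nat nat | FNeg fm | FAnd fm fm | FEx nat fm

primrec sat :: "'p hset set \<Rightarrow> (nat \<Rightarrow> 'p hset) \<Rightarrow> fm \<Rightarrow> bool" where
  "sat M e (FAtom i) \<longleftrightarrow> e i \<in> range hatom"
| "sat M e (FEq i j) \<longleftrightarrow> e i = e j"
| "sat M e (FMem i j) \<longleftrightarrow> hmem (e i) (e j)"
| "sat M e (FNeg \<phi>) \<longleftrightarrow> \<not> sat M e \<phi>"
| "sat M e (FAnd \<phi> \<psi>) \<longleftrightarrow> sat M e \<phi> \<and> sat M e \<psi>"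
| "sat M e (FEx i \<phi>) \<longleftrightarrow> (\<exists>x\<in>M. sat M (e(i := x)) \<phi>)"

definition elementary_submodel :: "'p hset set \<Rightarrow> bool" where
  "elementary_submodel M \<longleftrightarrow>
     M \<noteq> {} \<and> (\<forall>\<phi> e. range e \<subseteq> M \<longrightarrow> (sat M e \<phi> \<longleftrightarrow> sat UNIV e \<phi>))"


section \<open>Proper forcing\<close>

text \<open>A poset is given by a set \<open>P\<close> of conditions and an order \<open>le\<close>; \<open>le q p\<close> means that \<open>q\<close> is
  stronger than \<open>p\<close>.\<close>

definition dense_below :: "'p set \<Rightarrow> ('p \<Rightarrow> 'p \<Rightarrow> bool) \<Rightarrow> 'p \<Rightarrow> ('p \<Rightarrow> bool) \<Rightarrow> bool" where
  "dense_below P le p S \<longleftrightarrow> (\<forall>q\<in>P. le q p \<longrightarrow> (\<exists>r\<in>P. le r q \<and> S r))"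

definition dense_in :: "'p set \<Rightarrow> ('p \<Rightarrow> 'p \<Rightarrow> bool) \<Rightarrow> 'p set \<Rightarrow> bool" where
  "dense_in P le D \<longleftrightarrow> D \<subseteq> P \<and> (\<forall>p\<in>P. \<exists>d\<in>D. le d p)"

definition poset_code :: "'p set \<Rightarrow> ('p \<Rightarrow> 'p \<Rightarrow> bool) \<Rightarrow> 'p hset" where
  "poset_code P le = hpair (hcollect (hatom ` P))
     (hcollect {hpair (hatom p) (hatom q) | p q. p \<in> P \<and> q \<in> P \<and> le p q})"

text \<open>\<open>q\<close> is \<open>(M, P)\<close>-generic: for every dense \<open>D \<in> M\<close>, the set \<open>D \<inter> M\<close> is predense below \<open>q\<close>.\<close>

definition master_condition ::
    "'p hset set \<Rightarrow> 'p set \<Rightarrow> ('p \<Rightarrow> 'p \<Rightarrow> bool) \<Rightarrow> 'p \<Rightarrow> bool" where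
  "master_condition M P le q \<longleftrightarrow>
     (\<forall>D. dense_in P le D \<and> hcollect (hatom ` D) \<in> M \<longrightarrow>
        dense_below P le q (\<lambda>r. \<exists>d\<in>D. hatom d \<in> M \<and> le r d))"

definition proper_forcing :: "'p set \<Rightarrow> ('p \<Rightarrow> 'p \<Rightarrow> bool) \<Rightarrow> bool" where
  "proper_forcing P le \<longleftrightarrow>
     (\<forall>M. countable M \<and> elementary_submodel M \<and> poset_code P le \<in> M \<longrightarrow>
        (\<forall>p\<in>P. hatom p \<in> M \<longrightarrow> (\<exists>q\<in>P. le q p \<and> master_condition M P le q)))"


section \<open>The localization property\<close>

text \<open>A nice name for a subset of \<open>\<omega> \<times> \<omega>\<close> is a family \<open>\<tau>\<close> of sets of conditions; it names the set
  of all \<open>(k, j)\<close> for which the generic filter meets \<open>\<tau> k j\<close>. The definitions below spell out the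
  forcing relation for the statements \<open>(k, j) \<in> \<tau>\<close>, \<open>\<tau> \<in> \<omega>\<^sup>\<omega>\<close> (\<open>\<tau>\<close> is a total function)
  and \<open>\<tau> \<in> [T]\<close>, for a tree \<open>T\<close> in the ground model.\<close>

type_synonym 'p nice_name = "nat \<Rightarrow> nat \<Rightarrow> 'p set"

definition forces_pair ::
    "'p set \<Rightarrow> ('p \<Rightarrow> 'p \<Rightarrow> bool) \<Rightarrow> 'p \<Rightarrow> 'p nice_name \<Rightarrow> nat \<Rightarrow> nat \<Rightarrow> bool" where
  "forces_pair P le p \<tau> k j \<longleftrightarrow> dense_below P le p (\<lambda>r. \<exists>a\<in>\<tau> k j. le r a)"

definition forces_real ::
    "'p set \<Rightarrow> ('p \<Rightarrow> 'p \<Rightarrow> bool) \<Rightarrow> 'p \<Rightarrow> 'p nice_name \<Rightarrow> bool" where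
  "forces_real P le p \<tau> \<longleftrightarrow>
     (\<forall>k. dense_below P le p (\<lambda>r. \<exists>j. forces_pair P le r \<tau> k j)) \<and>
     (\<forall>k i j. i \<noteq> j \<longrightarrow>
        \<not> (\<exists>q\<in>P. le q p \<and> forces_pair P le q \<tau> k i \<and> forces_pair P le q \<tau> k j))"

definition forces_branch ::
    "'p set \<Rightarrow> ('p \<Rightarrow> 'p \<Rightarrow> bool) \<Rightarrow> 'p \<Rightarrow> 'p nice_name \<Rightarrow> nat list set \<Rightarrow> bool" where
  "forces_branch P le p \<tau> T \<longleftrightarrow>
     (\<forall>k. dense_below P le p
        (\<lambda>r. \<exists>s\<in>T. length s = k \<and> (\<forall>i<k. forces_pair P le r \<tau> i (s ! i))))"

definition omega_tree :: "nat list set \<Rightarrow> bool" where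
  "omega_tree T \<longleftrightarrow> (\<forall>t\<in>T. \<forall>s. prefix s t \<longrightarrow> s \<in> T)"

definition branching_le :: "nat \<Rightarrow> nat list set \<Rightarrow> bool" where
  "branching_le m T \<longleftrightarrow> (\<forall>s\<in>T. finite {j. s @ [j] \<in> T} \<and> card {j. s @ [j] \<in> T} \<le> m)"

definition localization_property :: "nat \<Rightarrow> 'p set \<Rightarrow> ('p \<Rightarrow> 'p \<Rightarrow> bool) \<Rightarrow> bool" where
  "localization_property m P le \<longleftrightarrow>
     (\<forall>\<tau>. (\<forall>k j. \<tau> k j \<subseteq> P) \<longrightarrow>
        (\<forall>p\<in>P. forces_real P le p \<tau> \<longrightarrow>
           dense_below P le p
             (\<lambda>q. \<exists>T. omega_tree T \<and> branching_le m T \<and> forces_branch P le q \<tau> T)))"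

end

theory Submission
  imports Defs
begin

text \<open>Properness is used only to read a name \<open>\<tau>\<close> for an element of \<open>\<omega>\<^sup>\<omega>\<close> in a Borel way: a master
  condition for a countable elementary submodel is, modulo the ideal, covered by countably many
  conditions which decide \<open>\<tau> k\<close>. What remains is the following statement without forcing: a
  Borel function from a positive Borel set to \<open>\<omega>\<^sup>\<omega>\<close> maps some positive Borel subset into the
  branches of an \<open>n\<close>-branching tree.

  This is proved by a fusion as in the \<open>G\<^sub>0\<close>-dichotomy. At stage \<open>k\<close> one has a large closed set of
  configurations, that is, families of points indexed by \<open>n\<^sup>k\<close>. In the next stage \<open>n\<close> of them are
  amalgamated in such a way that their points at a given node \<open>s k\<close> contain an edge of a given
  hypergraph. If all amalgams could be covered by a set in the ideal, then the points at \<open>s k\<close> of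
  the configurations outside this set would be an analytic anticlique, hence contained in a Borel
  anticlique, and the given set of configurations would be small. In the limit
  one gets a continuous image of \<open>n\<^sup>\<omega>\<close> in which the traces of anticliques are meager.
  Two nodes of stage \<open>k\<close> are either sent to different initial segments of the values, or to
  the same value in all configurations; in the latter case this remains true in all amalgams, so that
  a node of the tree of values gets at most \<open>n\<close> immediate successors from the amalgamation of \<open>n\<close>
  configurations.\<close>

section \<open>Polish structure on the natural numbers\<close>

text \<open>The discrete metric is supplied so that \<open>nat\<close>, and through products and
  countable powers also Baire space and the spaces of configurations, become Polish types.\<close>

instantiation nat :: metric_space
begin
definition dist_nat :: "nat \<Rightarrow> nat \<Rightarrow> real" where "dist_nat m n = (if m = n then 0 else 1)"
definition uniformity_nat :: "(nat \<times> nat) filter" where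
  "uniformity_nat = (INF e\<in>{0<..}. principal {(m, n). dist m n < e})"
instance
proof
  show "(uniformity :: (nat \<times> nat) filter) = (INF e\<in>{0<..}. principal {(m, n). dist m n < e})"
    by (rule uniformity_nat_def)
  show "open U \<longleftrightarrow> (\<forall>x\<in>U. eventually (\<lambda>(x', y). x' = x \<longrightarrow> y \<in> U) uniformity)" for U :: "nat set"
  proof -
    have "eventually (\<lambda>(x', y). x' = x \<longrightarrow> y \<in> U) uniformity" if "x \<in> U" for x
      unfolding uniformity_nat_def
      by (rule eventually_INF1[of 1]) (use that in \<open>auto simp: eventually_principal dist_nat_def split: if_splits\<close>)
    then show ?thesis by (simp add: open_discrete)
  qed
qed (auto simp: dist_nat_def split: if_splits)
end

instance nat :: polish_space
proof
  fix X :: "nat \<Rightarrow> nat" assume "Cauchy X"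
  then obtain N where "\<And>m n. m \<ge> N \<Longrightarrow> n \<ge> N \<Longrightarrow> dist (X m) (X n) < 1/2"
    using metric_CauchyD[of X "1/2"] by auto
  then have "dist (X n) (X N) < 1/2" if "n \<ge> N" for n using that by blast
  have "X n = X N" if "n \<ge> N" for n
    using \<open>\<And>n. n \<ge> N \<Longrightarrow> dist (X n) (X N) < 1/2\<close>[OF that]
    by (simp add: dist_nat_def split: if_splits)
  then have "X \<longlonglongrightarrow> X N"
    by (intro tendsto_eventually eventually_sequentiallyI)
  then show "convergent X" by (auto simp: convergent_def)
qed

instance prod :: (polish_space, polish_space) polish_space ..

section \<open>Projections of closed sets and the property of Baire\<close>

text \<open>For Polish \<open>'a\<close> these are the analytic sets. A closed set of pairs is kept
  instead of a parametrization because membership together with a witness is then preserved by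
  limits.\<close>

definition closed_projection :: "'a::topological_space set \<Rightarrow> bool" where
  "closed_projection A \<longleftrightarrow> (\<exists>C :: ('a \<times> (nat \<Rightarrow> nat)) set. closed C \<and> A = fst ` C)"

lemma closed_fun_coordinate_neq:
  "closed {p :: 'a::topological_space \<times> (nat \<Rightarrow> nat). snd p i \<noteq> j}"
proof -
  have "continuous_on UNIV (\<lambda>p :: 'a \<times> (nat \<Rightarrow> nat). snd p i)"
    by (rule continuous_on_product_then_coordinatewise) (intro continuous_intros)
  moreover have "{p :: 'a \<times> (nat \<Rightarrow> nat). snd p i \<noteq> j} = (\<lambda>p. snd p i) -` (- {j})"
    by auto
  moreover have "closed (- {j})" unfolding closed_def by (rule open_discrete)
  ultimately show ?thesis
    by (simp add: closed_vimage)
qed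

text \<open>The second coordinate is read as countably many columns. Column \<open>k\<close> starts
  with an index \<open>j\<close> and continues with a witness for \<open>x \<in> E k j\<close>, so
  that \<open>j\<close> becomes a continuous function of the witness.\<close>

lemma closed_projection_scheme:
  fixes E :: "nat \<Rightarrow> nat \<Rightarrow> 'a::topological_space set"
  assumes "\<And>k j. closed_projection (E k j)"
  obtains C :: "('a \<times> (nat \<Rightarrow> nat)) set"
    where "closed C" "\<And>x y k. (x, y) \<in> C \<Longrightarrow> x \<in> E k (y (prod_encode (k, 0)))"
      "fst ` C = {x. \<forall>k. \<exists>j. x \<in> E k j}"
proof -
  obtain D :: "nat \<Rightarrow> nat \<Rightarrow> ('a \<times> (nat \<Rightarrow> nat)) set"
    where D: "\<And>k j. closed (D k j)" "\<And>k j. E k j = fst ` D k j"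
    using assms unfolding closed_projection_def by metis
  \<comment> \<open>Quantifying over every \<open>j\<close> and allowing the entry to differ from
    \<open>j\<close> replaces a substitution for \<open>j\<close> by closed conditions, the
    inequality being closed because \<open>nat\<close> is discrete.\<close>
  define C where "C = {p. \<forall>k j. snd p (prod_encode (k, 0)) \<noteq> j \<or>
     (fst p, \<lambda>i. snd p (prod_encode (k, Suc i))) \<in> D k j}"
  have cl: "closed C"
    unfolding C_def
  proof (intro closed_Collect_all closed_Collect_disj closed_fun_coordinate_neq)
    fix k j
    have "continuous_on UNIV (\<lambda>p :: 'a \<times> (nat \<Rightarrow> nat). (fst p, \<lambda>i. snd p (prod_encode (k, Suc i))))"
      by (intro continuous_on_Pair continuous_on_fst continuous_on_id
          continuous_on_coordinatewise_then_product)
        (rule continuous_on_product_then_coordinatewise, intro continuous_intros)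
    from closed_vimage[OF D(1)[of k j] this]
    show "closed {p. (fst p, \<lambda>i. snd p (prod_encode (k, Suc i))) \<in> D k j}"
      by (simp add: vimage_def)
  qed
  have sound: "x \<in> E k (y (prod_encode (k, 0)))" if "(x, y) \<in> C" for x y k
    using that D(2)[of k] unfolding C_def by (force simp: image_iff)
  have "x \<in> fst ` C" if "\<forall>k. \<exists>j. x \<in> E k j" for x
  proof -
    from choice[OF that] obtain j where "\<forall>k. x \<in> E k (j k)" ..
    then have "\<forall>k. \<exists>v. (x, v) \<in> D k (j k)"
      unfolding D(2) by force
    from choice[OF this] obtain v where v: "\<And>k. (x, v k) \<in> D k (j k)"
      by blast
    define y where
      "y = (\<lambda>l. case prod_decode l of (k, i) \<Rightarrow> (case i of 0 \<Rightarrow> j k | Suc i \<Rightarrow> v k i))"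
    have "(x, y) \<in> C"
      using v by (auto simp: C_def y_def)
    then show ?thesis by force
  qed
  with sound have "fst ` C = {x. \<forall>k. \<exists>j. x \<in> E k j}" by fastforce
  with cl sound show thesis by (rule that)
qed

lemma closed_projection_Inter:
  fixes A :: "nat \<Rightarrow> 'a::topological_space set"
  assumes "\<And>k :: nat. closed_projection (A k)"
  shows "closed_projection (\<Inter>k. A k)"
proof -
  obtain C :: "('a \<times> (nat \<Rightarrow> nat)) set" where "closed C" "fst ` C = {x. \<forall>k. \<exists>j::nat. x \<in> A k}"
    using closed_projection_scheme[of "\<lambda>k _. A k"] assms by metis
  then show ?thesis unfolding closed_projection_def by (intro exI[of _ C]) auto
qed

lemma closed_projection_Union:
  fixes A :: "nat \<Rightarrow> 'a::topological_space set"
  assumes "\<And>k :: nat. closed_projection (A k)"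
  shows "closed_projection (\<Union>k. A k)"
proof -
  obtain C :: "('a \<times> (nat \<Rightarrow> nat)) set" where "closed C" "fst ` C = {x. \<forall>k::nat. \<exists>j. x \<in> A j}"
    using closed_projection_scheme[of "\<lambda>_ j. A j"] assms by metis
  then show ?thesis unfolding closed_projection_def by (intro exI[of _ C]) auto
qed

lemma closed_projection_closed:
  assumes "closed A"
  shows "closed_projection A"
proof -
  have "closed (A \<times> (UNIV :: (nat \<Rightarrow> nat) set))"
    using assms by (simp add: closed_Times)
  moreover have "A = fst ` (A \<times> (UNIV :: (nat \<Rightarrow> nat) set))"
    by (simp only: fst_image_times) simp
  ultimately show ?thesis
    unfolding closed_projection_def by (intro exI conjI)
qed

lemma closed_projection_open:
  fixes U :: "'a::metric_space set"
  assumes "open U"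
  shows "closed_projection U"
\<comment> \<open>The distance to an empty set is 0 by convention, so the sets \<open>A k\<close>
  below exhaust \<open>U\<close> only if its complement is nonempty.\<close>
proof (cases "U = UNIV")
  case True
  then show ?thesis by (simp add: closed_projection_closed)
next
  case False
  define A where "A k = {x. 1 / real (Suc k) \<le> infdist x (- U)}" for k
  have "closed (A k)" for k
    unfolding A_def by (intro closed_Collect_le continuous_on_const continuous_on_infdist continuous_on_id)
  moreover have "(\<Union>k. A k) = U"
  proof (intro set_eqI iffI)
    fix x assume "x \<in> (\<Union>k. A k)"
    then have "infdist x (- U) \<noteq> 0"
      by (auto simp: A_def)
    then show "x \<in> U" by (metis Compl_iff infdist_zero)
  next
    fix x assume "x \<in> U"
    then have "infdist x (- U) > 0"
      using assms False in_closed_iff_infdist_zero[of "- U" x] infdist_nonneg[of x "- U"]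
      by fastforce
    then obtain k where "1 / real (Suc k) < infdist x (- U)"
      by (rule nat_approx_posE)
    then have "x \<in> A k" by (simp add: A_def)
    then show "x \<in> (\<Union>k. A k)" by blast
  qed
  ultimately show ?thesis
    using closed_projection_Union[OF closed_projection_closed, of A] by simp
qed

lemma borel_closed_projection:
  fixes A :: "'a::metric_space set"
  assumes "A \<in> sets borel"
  shows "closed_projection A"
proof -
  have "A \<in> sigma_sets UNIV {S. open S}"
    using assms by (simp add: sets_borel)
  \<comment> \<open>The class is not closed under complements, so the induction carries a set and
    its complement together.\<close>
  then have "closed_projection A \<and> closed_projection (- A)"
  proof induction
    case (Basic a)
    then show ?case
      by (simp add: closed_projection_closed closed_projection_open closed_Compl)
  next
    case Empty
    show ?case by (simp add: closed_projection_closed)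
  next
    case (Compl a)
    then show ?case by (simp flip: Compl_eq_Diff_UNIV)
  next
    case (Union a)
    then show ?case
      by (simp add: closed_projection_Union closed_projection_Inter)
  qed
  then show ?thesis ..
qed

lemma open_nat_fun_iff:
  fixes U :: "(nat \<Rightarrow> nat) set"
  shows "open U \<longleftrightarrow> (\<forall>b\<in>U. \<exists>k. \<forall>b'. (\<forall>i<k. b' i = b i) \<longrightarrow> b' \<in> U)"
    (is "_ \<longleftrightarrow> ?R")
proof
  assume "open U"
  show ?R
  proof
    fix b assume "b \<in> U"
    with \<open>open U\<close>
    obtain X where X: "b \<in> (\<Pi>\<^sub>E i\<in>UNIV. X i)" "finite {i. X i \<noteq> UNIV}"
        "(\<Pi>\<^sub>E i\<in>UNIV. X i) \<subseteq> U"
      using product_topology_open_contains_basis[of "\<lambda>_. euclidean" UNIV U b]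
      unfolding open_fun_def by auto
    from X(2) obtain k where k: "\<And>i. X i \<noteq> UNIV \<Longrightarrow> i < k"
      using finite_nat_set_iff_bounded by auto
    have "b' \<in> U" if "\<forall>i<k. b' i = b i" for b'
    proof -
      have "b' i \<in> X i" for i
        using that X(1) k[of i] by (cases "X i = UNIV") (auto simp: PiE_iff)
      then show ?thesis using X(3) by (auto simp: PiE_iff)
    qed
    then show "\<exists>k. \<forall>b'. (\<forall>i<k. b' i = b i) \<longrightarrow> b' \<in> U" by blast
  qed
next
  assume U: ?R
  have *: "open {b'. \<forall>i<k. b' i = b i}" for k and b :: "nat \<Rightarrow> nat"
  proof -
    have "open ((\<lambda>b'. b' i) -` {b i})" for i
      by (intro open_vimage open_discrete continuous_on_product_coordinates)
    then have "open (\<Inter>i\<in>{..<k}. (\<lambda>b'. b' i) -` {b i})" by (intro open_INT) auto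
    moreover have "(\<Inter>i\<in>{..<k}. (\<lambda>b'. b' i) -` {b i}) = {b'. \<forall>i<k. b' i = b i}" by auto
    ultimately show ?thesis by simp
  qed
  show "open U"
    unfolding open_subopen[of U]
  proof
    fix b assume "b \<in> U"
    with U obtain k where "\<forall>b'. (\<forall>i<k. b' i = b i) \<longrightarrow> b' \<in> U" by blast
    then show "\<exists>T. open T \<and> b \<in> T \<and> T \<subseteq> U"
      by (intro exI[of _ "{b'. \<forall>i<k. b' i = b i}"]) (use *[where b=b] in auto)
  qed
qed

section \<open>Meager sets and the property of Baire\<close>

definition meager :: "'a::topological_space set \<Rightarrow> bool" where
  "meager A \<longleftrightarrow> (\<exists>\<K>. countable \<K> \<and> (\<forall>K\<in>\<K>. closed K \<and> interior K = {}) \<and> A \<subseteq> \<Union>\<K>)"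

lemma meager_subset:
  assumes "meager B" "A \<subseteq> B"
  shows "meager A"
proof -
  obtain \<K> where "countable \<K>" "\<forall>K\<in>\<K>. closed K \<and> interior K = {}" "B \<subseteq> \<Union>\<K>"
    using assms(1) unfolding meager_def by auto
  with assms(2) show ?thesis
    unfolding meager_def by (intro exI[of _ \<K>]) simp
qed

lemma meager_UN:
  assumes "countable J" "\<And>j. j \<in> J \<Longrightarrow> meager (A j)"
  shows "meager (\<Union>j\<in>J. A j)"
proof -
  obtain \<K> where \<K>: "\<And>j. j \<in> J \<Longrightarrow> countable (\<K> j)"
      "\<And>j K. j \<in> J \<Longrightarrow> K \<in> \<K> j \<Longrightarrow> closed K \<and> interior K = {}"
      "\<And>j. j \<in> J \<Longrightarrow> A j \<subseteq> \<Union>(\<K> j)"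
    using assms(2) unfolding meager_def by metis
  have "countable (\<Union>j\<in>J. \<K> j)"
    using assms(1) \<K>(1) by (rule countable_UN)
  moreover have "\<forall>K\<in>(\<Union>j\<in>J. \<K> j). closed K \<and> interior K = {}"
    using \<K>(2) by blast
  moreover have "(\<Union>j\<in>J. A j) \<subseteq> \<Union>(\<Union>j\<in>J. \<K> j)"
  proof
    fix x assume "x \<in> (\<Union>j\<in>J. A j)"
    then obtain j where j: "j \<in> J" "x \<in> A j" by blast
    with \<K>(3) obtain K where "K \<in> \<K> j" "x \<in> K" by blast
    with j(1) show "x \<in> \<Union>(\<Union>j\<in>J. \<K> j)" by blast
  qed
  ultimately show ?thesis unfolding meager_def by (intro exI conjI)
qed

lemma not_meager_UNIV: "\<not> meager (UNIV :: 'a::polish_space set)"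
proof
  assume "meager (UNIV :: 'a set)"
  then obtain \<K> :: "'a set set" where \<K>: "countable \<K>" "\<And>K. K \<in> \<K> \<Longrightarrow> closed K \<and> interior K = {}" "\<Union>\<K> = UNIV"
    unfolding meager_def by auto
  have "euclidean interior_of \<Union>\<K> = {}"
    by (rule Baire_category_alt) (use \<K> in \<open>auto simp: completely_metrizable_space_euclidean\<close>)
  with \<K>(3) show False by simp
qed

text \<open>An open set inside the preimage of \<open>K\<close> is mapped to an open subset of
  \<open>K\<close>, hence is empty if \<open>K\<close> has empty interior.\<close>

lemma meager_vimage:
  assumes "meager A" "continuous_on UNIV \<phi>" "\<And>U. open U \<Longrightarrow> open (\<phi> ` U)"
  shows "meager (\<phi> -` A)"
proof -
  obtain \<K> where \<K>: "countable \<K>" "\<And>K. K \<in> \<K> \<Longrightarrow> closed K \<and> interior K = {}" "A \<subseteq> \<Union>\<K>"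
    using assms(1) unfolding meager_def by auto
  have "closed (\<phi> -` K) \<and> interior (\<phi> -` K) = {}" if "K \<in> \<K>" for K
  proof
    show "closed (\<phi> -` K)" using \<K>(2)[OF that] assms(2) by (intro closed_vimage) auto
    have "\<phi> ` interior (\<phi> -` K) \<subseteq> interior K"
      by (intro interior_maximal assms(3) open_interior) (use interior_subset in blast)
    then show "interior (\<phi> -` K) = {}" using \<K>(2)[OF that] by blast
  qed
  then show ?thesis
    unfolding meager_def using \<K>(1,3) by (intro exI[of _ "(-`) \<phi> ` \<K>"]) (auto simp: subset_iff)
qed

text \<open>Equality with an open set modulo meager sets passes to countable unions directly, and to
  complements because the boundary of an open set is nowhere dense.\<close>

lemma borel_baire_property:
  assumes "A \<in> sets borel"
  obtains U where "open U" "meager (U - A)" "meager (A - U)"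
proof -
  have "A \<in> sigma_sets UNIV {S. open S}"
    using assms by (simp add: sets_borel)
  then have "\<exists>U. open U \<and> meager (U - A) \<and> meager (A - U)"
  proof induction
    case (Basic a)
    then show ?case by (intro exI[of _ a]) (auto simp: meager_def)
  next
    case Empty
    show ?case by (intro exI[of _ "{}"]) (auto simp: meager_def)
  next
    case (Compl a)
    then obtain U where U: "open U" "meager (U - a)" "meager (a - U)" by blast
    let ?K = "- U - interior (- U)"
    have "interior ?K = {}"
      using interior_mono[of ?K "- U"] interior_subset[of ?K] by blast
    then have "meager ?K"
      unfolding meager_def using U(1) by (intro exI[of _ "{?K}"]) (auto simp: closed_Diff)
    then have "meager (\<Union>b\<in>{True, False}. if b then ?K else U - a)"
      using U by (intro meager_UN) (auto split: if_splits)
    then have 1: "meager ((UNIV - a) - interior (- U))"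
      by (rule meager_subset) auto
    have 2: "meager (interior (- U) - (UNIV - a))"
      by (rule meager_subset[OF U(3)]) (use interior_subset in blast)
    show ?case using 1 2 by blast
  next
    case (Union a)
    then obtain U where U: "\<And>i. open (U i)" "\<And>i. meager (U i - a i)" "\<And>i. meager (a i - U i)"
      by metis
    have "meager (\<Union>i::nat. U i - a i)" "meager (\<Union>i::nat. a i - U i)"
      using U by (auto intro!: meager_UN)
    then have "meager ((\<Union>i. U i) - (\<Union>i. a i))" "meager ((\<Union>i. a i) - (\<Union>i. U i))"
      using meager_subset[of "\<Union>i::nat. U i - a i" "(\<Union>i. U i) - (\<Union>i. a i)"]
        meager_subset[of "\<Union>i::nat. a i - U i" "(\<Union>i. a i) - (\<Union>i. U i)"] by blast+
    then show ?case using U(1) by (intro exI[of _ "\<Union>i. U i"]) auto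
  qed
  then show thesis using that by blast
qed

section \<open>The ideal and the space of sequences\<close>

lemma sigma_ideal_generatedI:
  "\<C> \<subseteq> \<S> \<Longrightarrow> countable \<C> \<Longrightarrow> A \<subseteq> \<Union>\<C> \<Longrightarrow> A \<in> sigma_ideal_generated \<S>"
  unfolding sigma_ideal_generated_def mem_Collect_eq by (intro exI[of _ \<C>] conjI)

lemma sigma_ideal_generatedE:
  assumes "A \<in> sigma_ideal_generated \<S>"
  obtains \<C> where "\<C> \<subseteq> \<S>" "countable \<C>" "A \<subseteq> \<Union>\<C>"
  using assms unfolding sigma_ideal_generated_def mem_Collect_eq by (elim exE conjE)

lemma sigma_ideal_generated_subset:
  assumes "A \<in> sigma_ideal_generated \<S>" "B \<subseteq> A"
  shows "B \<in> sigma_ideal_generated \<S>"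
proof -
  obtain \<C> where "\<C> \<subseteq> \<S>" "countable \<C>" "A \<subseteq> \<Union>\<C>"
    using assms(1) by (rule sigma_ideal_generatedE)
  then show ?thesis using assms(2) by (intro sigma_ideal_generatedI[of \<C>]) simp_all
qed

lemma sigma_ideal_generated_UN:
  assumes "countable J" "\<And>j. j \<in> J \<Longrightarrow> A j \<in> sigma_ideal_generated \<S>"
  shows "(\<Union>j\<in>J. A j) \<in> sigma_ideal_generated \<S>"
proof -
  obtain \<C> where \<C>: "\<And>j. j \<in> J \<Longrightarrow> \<C> j \<subseteq> \<S>" "\<And>j. j \<in> J \<Longrightarrow> countable (\<C> j)"
      "\<And>j. j \<in> J \<Longrightarrow> A j \<subseteq> \<Union>(\<C> j)"
    using assms(2) unfolding sigma_ideal_generated_def by simp metis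
  have "(\<Union>j\<in>J. \<C> j) \<subseteq> \<S>" using \<C>(1) by (rule UN_least)
  moreover have "countable (\<Union>j\<in>J. \<C> j)" using assms(1) \<C>(2) by (rule countable_UN)
  moreover have "(\<Union>j\<in>J. A j) \<subseteq> \<Union>(\<Union>j\<in>J. \<C> j)"
  proof (rule UN_least)
    fix j assume "j \<in> J"
    then have "\<C> j \<subseteq> (\<Union>j\<in>J. \<C> j)" by (rule UN_upper)
    from subset_trans[OF \<C>(3)[OF \<open>j \<in> J\<close>] Union_mono[OF this]]
    show "A j \<subseteq> \<Union>(\<Union>j\<in>J. \<C> j)" .
  qed
  ultimately show ?thesis by (rule sigma_ideal_generatedI)
qed

lemma sigma_ideal_generated_Un:
  assumes "A \<in> sigma_ideal_generated \<S>" "B \<in> sigma_ideal_generated \<S>"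
  shows "A \<union> B \<in> sigma_ideal_generated \<S>"
proof -
  have "(\<Union>b\<in>{True, False}. if b then A else B) \<in> sigma_ideal_generated \<S>"
    by (rule sigma_ideal_generated_UN) (simp_all add: assms)
  then show ?thesis by (simp add: Un_commute)
qed

lemma sigma_ideal_generated_base: "A \<in> \<S> \<Longrightarrow> A \<in> sigma_ideal_generated \<S>"
  by (rule sigma_ideal_generatedI[of "{A}"]) simp_all

lemma sigma_ideal_generated_empty: "{} \<in> sigma_ideal_generated \<S>"
  by (rule sigma_ideal_generatedI[of "{}"]) simp_all

lemmas hypergraph_ideal_subset =
    sigma_ideal_generated_subset[of _ "{B \<in> sets borel. \<exists>G\<in>\<G>. anticlique G B}" for \<G>, folded hypergraph_ideal_def]
  and hypergraph_ideal_UN =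
    sigma_ideal_generated_UN[where \<S> = "{B \<in> sets borel. \<exists>G\<in>\<G>. anticlique G B}" for \<G>, folded hypergraph_ideal_def]
  and hypergraph_ideal_Un =
    sigma_ideal_generated_Un[of _ "{B \<in> sets borel. \<exists>G\<in>\<G>. anticlique G B}" for \<G>, folded hypergraph_ideal_def]
  and hypergraph_ideal_empty =
    sigma_ideal_generated_empty[of "{B \<in> sets borel. \<exists>G\<in>\<G>. anticlique G B}" for \<G>, folded hypergraph_ideal_def]

lemma anticlique_in_hypergraph_ideal:
  "B \<in> sets borel \<Longrightarrow> G \<in> \<G> \<Longrightarrow> anticlique G B \<Longrightarrow> B \<in> hypergraph_ideal \<G>"
  unfolding hypergraph_ideal_def by (intro sigma_ideal_generated_base CollectI conjI bexI)

lemma hypergraph_ideal_borel_hull: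
  assumes "A \<in> hypergraph_ideal \<G>"
  obtains N where "N \<in> hypergraph_ideal \<G>" "N \<in> sets borel" "A \<subseteq> N"
proof -
  obtain \<C> where \<C>: "\<C> \<subseteq> {B \<in> sets borel. \<exists>G\<in>\<G>. anticlique G B}" "countable \<C>" "A \<subseteq> \<Union>\<C>"
    using assms unfolding hypergraph_ideal_def sigma_ideal_generated_def by auto
  have "\<Union>\<C> \<in> hypergraph_ideal \<G>"
    using \<C>(1,2) unfolding hypergraph_ideal_def sigma_ideal_generated_def by auto
  moreover have "\<Union>\<C> \<in> sets borel" using \<C>(1,2) by (intro sets.countable_Union) auto
  ultimately show thesis using that \<C>(3) by auto
qed

section \<open>Continuous maps into the space of sequences\<close>

lemma continuous_seq_space_open:
  assumes "continuous_map euclidean seq_space F" "openin seq_space U"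
  shows "open {y. F y \<in> U}"
  using openin_continuous_map_preimage[OF assms] by simp

lemma openin_seq_space_length: "openin seq_space {e \<in> seqs UNIV. fst e = l}"
proof -
  have "{s. (i, s) \<in> {e \<in> seqs UNIV. fst e = l}} = (if i = l then {j. enat j < i} \<rightarrow>\<^sub>E UNIV else {})" for i
    by (auto simp: seqs_def)
  note * = this
  show ?thesis
    unfolding seq_space_def openin_sum_topology
  proof (intro conjI ballI)
    fix i
    show "openin (product_topology (\<lambda>_. euclidean) {j. enat j < i})
        {s. (i, s) \<in> {e \<in> seqs UNIV. fst e = l}}"
      unfolding * using openin_topspace[of "product_topology (\<lambda>_. euclidean) {j. enat j < i}"] by (cases "i = l") simp_all
  qed (auto simp: seqs_def comp_def)
qed

lemma openin_seq_space_coordinate: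
  assumes "open S" "enat i < l"
  shows "openin seq_space {e \<in> seqs UNIV. fst e = l \<and> snd e i \<in> S}"
proof -
  have *: "{s. (k, s) \<in> {e \<in> seqs UNIV. fst e = l \<and> snd e i \<in> S}} =
      (if k = l then {s \<in> topspace (product_topology (\<lambda>_. euclidean) {j. enat j < l}). s i \<in> S} else {})" for k
    by (auto simp: seqs_def)
  have "openin (product_topology (\<lambda>_. euclidean) {j. enat j < l})
      {s \<in> topspace (product_topology (\<lambda>_. euclidean) {j. enat j < l}). s i \<in> S}"
    by (rule openin_continuous_map_preimage[OF continuous_map_product_projection])
      (use assms in auto)
  then show ?thesis
    unfolding seq_space_def openin_sum_topology *
    by (auto simp: seqs_def comp_def)
qed

lemma seq_space_range:
  "continuous_map euclidean seq_space F \<Longrightarrow> F y \<in> seqs UNIV"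
  by (simp add: continuous_map_def topspace_seq_space Pi_iff)

lemma open_seq_space_length:
  assumes "continuous_map euclidean seq_space F"
  shows "open {y. fst (F y) = l}"
  using continuous_seq_space_open[OF assms openin_seq_space_length, of l]
  by (simp add: seq_space_range[OF assms])

lemma open_seq_space_coordinate:
  assumes "continuous_map euclidean seq_space F" "open S" "enat i < l"
  shows "open {y. fst (F y) = l \<and> snd (F y) i \<in> S}"
  using continuous_seq_space_open[OF assms(1) openin_seq_space_coordinate[OF assms(2,3)]]
  by (simp add: seq_space_range[OF assms(1)])

text \<open>Sequences of one length form an open summand of the space, which carries the product
  topology. This turns limits of edge witnesses into edge witnesses.\<close>

lemma seq_space_limit:
  assumes F: "continuous_map euclidean seq_space F" and y: "y \<longlonglongrightarrow> z" and l: "\<And>k :: nat. fst (F (y k)) = l"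
  shows "fst (F z) = l" and "enat i < l \<Longrightarrow> (\<lambda>k. snd (F (y k)) i) \<longlonglongrightarrow> snd (F z) i"
proof -
  have "eventually (\<lambda>k. y k \<in> {y. fst (F y) = fst (F z)}) sequentially"
    by (rule topological_tendstoD[OF y open_seq_space_length[OF F]]) simp
  then show 1: "fst (F z) = l" using l by (auto dest: eventually_happens)
  assume i: "enat i < l"
  show "(\<lambda>k. snd (F (y k)) i) \<longlonglongrightarrow> snd (F z) i"
  proof (rule topological_tendstoI)
    fix S assume "open S" "snd (F z) i \<in> S"
    then have "eventually (\<lambda>k. y k \<in> {y. fst (F y) = l \<and> snd (F y) i \<in> S}) sequentially"
      using 1 by (intro topological_tendstoD[OF y open_seq_space_coordinate[OF F _ i]]) auto
    then show "eventually (\<lambda>k. snd (F (y k)) i \<in> S) sequentially"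
      by (rule eventually_mono) simp
  qed
qed

section \<open>Borel hulls of analytic anticliques\<close>

lemma dense_sequence:
  obtains d :: "nat \<Rightarrow> 'a::polish_space" where "\<And>x e. e > 0 \<Longrightarrow> \<exists>i. dist x (d i) < e"
proof -
  obtain D :: "'a set" where D: "countable D" "\<And>X. open X \<Longrightarrow> X \<noteq> {} \<Longrightarrow> \<exists>d\<in>D. d \<in> X"
    using countable_dense_exists by auto
  have "D \<noteq> {}" using D(2)[of UNIV] by auto
  have "\<exists>i. dist x (from_nat_into D i) < e" if "e > 0" for x e
  proof -
    have "ball x e \<noteq> {}" using centre_in_ball[of x e] that by blast
    from D(2)[OF open_ball this] obtain y where "y \<in> D" "y \<in> ball x e" by blast
    then show ?thesis
      using from_nat_into_surj[OF D(1) \<open>y \<in> D\<close>] by auto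
  qed
  then show thesis by (rule that)
qed

text \<open>The diameter bounds make every selector \<open>a\<close> Cauchy. The limit may lie
  outside the sets, but the weak distance bound survives the passage to the limit. It starts at
  \<open>Suc k\<close>, so that \<open>A 0\<close> may be arbitrarily large.\<close>

lemma shrinking_sets_limit:
  fixes A :: "nat \<Rightarrow> 'a::complete_space set"
  assumes dec: "\<And>k. A (Suc k) \<subseteq> A k"
    and small: "\<And>k x y. x \<in> A (Suc k) \<Longrightarrow> y \<in> A (Suc k) \<Longrightarrow> dist x y \<le> 1 / real (Suc k)"
    and a: "\<And>k. a k \<in> A k"
  shows "\<exists>l. a \<longlonglongrightarrow> l \<and> (\<forall>k. \<forall>x\<in>A (Suc k). dist x l \<le> 1 / real (Suc k))"
proof -
  have mono: "A n \<subseteq> A m" if "m \<le> n" for m n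
    using that by (rule lift_Suc_antimono_le[of A, OF dec])
  have "Cauchy a"
  proof (rule metric_CauchyI)
    fix e :: real assume "e > 0"
    then obtain k where k: "1 / real (Suc k) < e" by (rule nat_approx_posE)
    have "dist (a m) (a n) < e" if "m \<ge> Suc k" "n \<ge> Suc k" for m n
      using small[of "a m" k "a n"] a[of m] a[of n] mono[OF that(1)] mono[OF that(2)] k by force
    then show "\<exists>M. \<forall>m\<ge>M. \<forall>n\<ge>M. dist (a m) (a n) < e" by blast
  qed
  then obtain l where l: "a \<longlonglongrightarrow> l"
    using Cauchy_convergent unfolding convergent_def by blast
  have "dist x l \<le> 1 / real (Suc k)" if "x \<in> A (Suc k)" for k x
  proof (rule Lim_bounded)
    show "(\<lambda>n. dist x (a n)) \<longlonglongrightarrow> dist x l" by (intro tendsto_intros l)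
    show "\<forall>n\<ge>Suc k. dist x (a n) \<le> 1 / real (Suc k)"
      using small[OF that] a mono by blast
  qed
  with l show ?thesis by blast
qed

text \<open>This is Lusin separation of an analytic set of \<open>m\<close>-tuples from a box, by a
  Borel box. The sides may differ, so that each can be refined separately even when all of them
  start as the same set.\<close>

definition separated ::
    "((nat \<Rightarrow> nat) \<Rightarrow> enat \<times> (nat \<Rightarrow> 'a::topological_space)) \<Rightarrow> nat \<Rightarrow>
     (nat \<Rightarrow> nat) set \<Rightarrow> (nat \<Rightarrow> 'a set) \<Rightarrow> bool" where
  "separated F m U V \<longleftrightarrow> (\<exists>B. (\<forall>i<m. B i \<in> sets borel \<and> V i \<subseteq> B i) \<and>
     (\<forall>y\<in>U. fst (F y) = enat m \<longrightarrow> (\<exists>i<m. snd (F y) i \<notin> B i)))"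

lemma separatedI:
  assumes "\<And>i. i < m \<Longrightarrow> B i \<in> sets borel" "\<And>i. i < m \<Longrightarrow> V i \<subseteq> B i"
    "\<And>y. y \<in> U \<Longrightarrow> fst (F y) = enat m \<Longrightarrow> \<exists>i<m. snd (F y) i \<notin> B i"
  shows "separated F m U V"
  unfolding separated_def using assms by (intro exI[of _ B] conjI allI impI ballI)

lemma separated_UN_left:
  assumes "\<And>c :: nat. separated F m (U c) V"
  shows "separated F m (\<Union>c. U c) V"
proof -
  have "\<forall>c. \<exists>B. (\<forall>i<m. B i \<in> sets borel \<and> V i \<subseteq> B i) \<and>
     (\<forall>y\<in>U c. fst (F y) = enat m \<longrightarrow> (\<exists>i<m. snd (F y) i \<notin> B i))"
    using assms by (simp only: separated_def) simp
  from choice[OF this] obtain B where "\<forall>c. (\<forall>i<m. B c i \<in> sets borel \<and> V i \<subseteq> B c i) \<and>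
     (\<forall>y\<in>U c. fst (F y) = enat m \<longrightarrow> (\<exists>i<m. snd (F y) i \<notin> B c i))" ..
  then have B: "\<And>c i. i < m \<Longrightarrow> B c i \<in> sets borel"
      "\<And>c i. i < m \<Longrightarrow> V i \<subseteq> B c i"
      "\<And>c y. y \<in> U c \<Longrightarrow> fst (F y) = enat m \<Longrightarrow> \<exists>i<m. snd (F y) i \<notin> B c i"
    by blast+
  show ?thesis
  proof (rule separatedI[of _ "\<lambda>i. \<Inter>c. B c i"])
    show "(\<Inter>c. B c i) \<in> sets borel" if "i < m" for i
      using B(1)[OF that] by (intro sets.countable_INT) auto
    show "V i \<subseteq> (\<Inter>c. B c i)" if "i < m" for i using B(2)[OF that] by auto
    show "\<exists>i<m. snd (F y) i \<notin> (\<Inter>c. B c i)" if "y \<in> (\<Union>c. U c)" "fst (F y) = enat m" for y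
    proof -
      obtain c where "y \<in> U c" using \<open>y \<in> (\<Union>c. U c)\<close> by blast
      from B(3)[OF this that(2)] obtain i where "i < m" "snd (F y) i \<notin> B c i" by blast
      then show ?thesis by blast
    qed
  qed
qed

text \<open>Unite the Borel sides at coordinate \<open>i\<close> and intersect them at the others:
  an edge in this box has its entry at \<open>i\<close> in some \<open>B c i\<close>, so it would
  lie in the box for that \<open>c\<close>.\<close>

lemma separated_UN_right:
  assumes "\<And>c :: nat. separated F m U (V(i := A c))"
  shows "separated F m U (V(i := \<Union>c. A c))"
proof -
  have "\<forall>c. \<exists>B. (\<forall>j<m. B j \<in> sets borel \<and> (V(i := A c)) j \<subseteq> B j) \<and>
     (\<forall>y\<in>U. fst (F y) = enat m \<longrightarrow> (\<exists>j<m. snd (F y) j \<notin> B j))"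
    using assms by (simp only: separated_def) simp
  from choice[OF this] obtain B where
    "\<forall>c. (\<forall>j<m. B c j \<in> sets borel \<and> (V(i := A c)) j \<subseteq> B c j) \<and>
     (\<forall>y\<in>U. fst (F y) = enat m \<longrightarrow> (\<exists>j<m. snd (F y) j \<notin> B c j))" ..
  then have B: "\<And>c j. j < m \<Longrightarrow> B c j \<in> sets borel"
      "\<And>c j. j < m \<Longrightarrow> (V(i := A c)) j \<subseteq> B c j"
      "\<And>c y. y \<in> U \<Longrightarrow> fst (F y) = enat m \<Longrightarrow> \<exists>j<m. snd (F y) j \<notin> B c j"
    by blast+
  show ?thesis
  proof (rule separatedI[of _ "\<lambda>j. if j = i then (\<Union>c. B c j) else (\<Inter>c. B c j)"])
    show "(if j = i then (\<Union>c. B c j) else (\<Inter>c. B c j)) \<in> sets borel" if "j < m" for j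
      using B(1)[OF that] by (auto intro!: sets.countable_INT sets.countable_UN)
    show "(V(i := \<Union>c. A c)) j \<subseteq> (if j = i then (\<Union>c. B c j) else (\<Inter>c. B c j))" if "j < m" for j
    proof (cases "j = i")
      case True
      have "A c \<subseteq> (\<Union>c. B c j)" for c using B(2)[OF that, of c] True by auto
      then show ?thesis using True by auto
    next
      case False
      then have "V j \<subseteq> B c j" for c using B(2)[OF that, of c] by auto
      then show ?thesis using False by auto
    qed
    show "\<exists>j<m. snd (F y) j \<notin> (if j = i then (\<Union>c. B c j) else (\<Inter>c. B c j))"
      if y: "y \<in> U" "fst (F y) = enat m" for y
    proof (rule ccontr)
      assume neg: "\<not> ?thesis"
      obtain c where c: "i < m \<Longrightarrow> snd (F y) i \<in> B c i"
      proof (cases "i < m")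
        case True
        then have "snd (F y) i \<in> (\<Union>c. B c i)" using neg by auto
        then show ?thesis using that by blast
      qed (use that in blast)
      obtain j where j: "j < m" "snd (F y) j \<notin> B c j" using B(3)[OF y] by blast
      then show False using neg c by (cases "j = i") auto
    qed
  qed
qed

lemma separated_ball_left:
  assumes "\<not> separated F m U V" "e > 0"
  obtains U' where "U' \<subseteq> U" "\<not> separated F m U' V" "\<And>x y. x \<in> U' \<Longrightarrow> y \<in> U' \<Longrightarrow> dist x y \<le> e"
proof -
  obtain d :: "nat \<Rightarrow> nat \<Rightarrow> nat" where d: "\<And>x e. e > 0 \<Longrightarrow> \<exists>i. dist x (d i) < e"
    by (rule dense_sequence) blast
  let ?U = "\<lambda>c. {x \<in> U. dist x (d c) < e / 2}"
  have "(\<Union>c. ?U c) = U" using d[of "e / 2"] assms(2) by auto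
  then obtain c where c: "\<not> separated F m (?U c) V"
    using assms(1) separated_UN_left[of F m ?U V] by metis
  have "dist x y \<le> e" if "x \<in> ?U c" "y \<in> ?U c" for x y
    using that dist_triangle2[of x y "d c"] by auto
  with c show thesis by (intro that[of "?U c"]) auto
qed

text \<open>The coordinates are treated one after another; each time
  \<open>separated_UN_right\<close> allows one of countably many small pieces to be kept.\<close>

lemma separated_ball_right:
  fixes W :: "nat \<Rightarrow> 'q::polish_space set"
  assumes "\<not> separated F m U (\<lambda>i. \<xi> ` W i)" "e > 0"
  shows "\<exists>W'. (\<forall>i. W' i \<subseteq> W i) \<and> \<not> separated F m U (\<lambda>i. \<xi> ` W' i) \<and>
    (\<forall>i<k. \<forall>x\<in>W' i. \<forall>y\<in>W' i. dist x y \<le> e)"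
proof (induction k)
  case 0
  then show ?case using assms(1) by (intro exI[of _ W]) auto
next
  case (Suc k)
  then obtain W' where W': "\<And>i. W' i \<subseteq> W i" "\<not> separated F m U (\<lambda>i. \<xi> ` W' i)"
    "\<And>i x y. i < k \<Longrightarrow> x \<in> W' i \<Longrightarrow> y \<in> W' i \<Longrightarrow> dist x y \<le> e" by blast
  obtain d :: "nat \<Rightarrow> 'q" where d: "\<And>x e. e > 0 \<Longrightarrow> \<exists>i. dist x (d i) < e"
    by (rule dense_sequence) blast
  let ?A = "\<lambda>c. {x \<in> W' k. dist x (d c) < e / 2}"
  have "\<exists>c. \<not> separated F m U ((\<lambda>i. \<xi> ` W' i)(k := \<xi> ` ?A c))"
  proof (rule ccontr)
    assume "\<not> ?thesis"
    then have "separated F m U ((\<lambda>i. \<xi> ` W' i)(k := \<Union>c. \<xi> ` ?A c))"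
      by (intro separated_UN_right) blast
    moreover have "(\<Union>c. \<xi> ` ?A c) = \<xi> ` W' k"
    proof -
      have "(\<Union>c. ?A c) = W' k" using d[of "e / 2"] assms(2) by auto
      then show ?thesis by (simp flip: image_UN)
    qed
    ultimately show False using W'(2) by (simp add: fun_upd_idem)
  qed
  then obtain c where c: "\<not> separated F m U ((\<lambda>i. \<xi> ` W' i)(k := \<xi> ` ?A c))" ..
  have eq: "(\<lambda>i. \<xi> ` W' i)(k := \<xi> ` ?A c) = (\<lambda>i. \<xi> ` (W'(k := ?A c)) i)"
    by (rule ext) simp
  have small: "dist x y \<le> e" if "x \<in> ?A c" "y \<in> ?A c" for x y
    using that dist_triangle2[of x y "d c"] by auto
  show ?case
  proof (intro exI[of _ "W'(k := ?A c)"] conjI allI impI ballI)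
    show "(W'(k := ?A c)) i \<subseteq> W i" for i using W'(1)[of i] W'(1)[of k] by auto
    show "\<not> separated F m U (\<lambda>i. \<xi> ` (W'(k := ?A c)) i)" using c unfolding eq .
    show "dist x y \<le> e" if "i < Suc k" "x \<in> (W'(k := ?A c)) i" "y \<in> (W'(k := ?A c)) i" for i x y
      using that W'(3)[of i x y] small[of x y] by (cases "i = k") auto
  qed
qed

text \<open>Failure of separation passes to pieces of diameter tending to 0, which close in on a
  point \<open>u'\<close> and on points \<open>w' i\<close> of \<open>D\<close>. The tuple of the
  \<open>\<xi> (w' i)\<close> is not the edge \<open>F u'\<close>, and by continuity some stage of
  the pieces is separated after all.\<close>

lemma separated_image:
  fixes F :: "(nat \<Rightarrow> nat) \<Rightarrow> enat \<times> (nat \<Rightarrow> 'a::polish_space)"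
    and \<xi> :: "'q::polish_space \<Rightarrow> 'a"
  assumes F: "continuous_map euclidean seq_space F" and \<xi>: "continuous_on UNIV \<xi>" and D: "closed D"
    and no_edge: "\<And>y. fst (F y) = enat m \<Longrightarrow> \<exists>i<m. snd (F y) i \<notin> \<xi> ` D"
  shows "separated F m UNIV (\<lambda>_. \<xi> ` D)"
proof (rule ccontr)
  assume neg: "\<not> ?thesis"
  define P where "P k s \<longleftrightarrow> \<not> separated F m (fst s) (\<lambda>i. \<xi> ` snd s i) \<and> (\<forall>i. snd s i \<subseteq> D) \<and>
    (0 < k \<longrightarrow> (\<forall>x\<in>fst s. \<forall>y\<in>fst s. dist x y \<le> 1 / real k) \<and>
      (\<forall>i<m. \<forall>x\<in>snd s i. \<forall>y\<in>snd s i. dist x y \<le> 1 / real k))"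
    for k and s :: "(nat \<Rightarrow> nat) set \<times> (nat \<Rightarrow> 'q set)"
  have "\<exists>s. \<forall>k. P k (s k) \<and> (fst (s (Suc k)) \<subseteq> fst (s k) \<and> (\<forall>i. snd (s (Suc k)) i \<subseteq> snd (s k) i))"
  proof (rule dependent_nat_choice)
    show "\<exists>s. P 0 s" using neg by (intro exI[of _ "(UNIV, \<lambda>_. D)"]) (simp add: P_def)
    fix s k assume s: "P k s"
    let ?e = "1 / real (Suc k)"
    have e: "?e > 0" by simp
    obtain U' where U': "U' \<subseteq> fst s" "\<not> separated F m U' (\<lambda>i. \<xi> ` snd s i)"
        "\<And>x y. x \<in> U' \<Longrightarrow> y \<in> U' \<Longrightarrow> dist x y \<le> ?e"
      using s e unfolding P_def by (metis separated_ball_left)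
    obtain W' where W': "\<And>i. W' i \<subseteq> snd s i" "\<not> separated F m U' (\<lambda>i. \<xi> ` W' i)"
        "\<And>i x y. i < m \<Longrightarrow> x \<in> W' i \<Longrightarrow> y \<in> W' i \<Longrightarrow> dist x y \<le> ?e"
      using separated_ball_right[OF U'(2) e, of m] by blast
    have "P (Suc k) (U', W')"
      unfolding P_def
    proof (intro conjI allI impI ballI)
      show "snd (U', W') i \<subseteq> D" for i
        using s W'(1)[of i] unfolding P_def by (auto dest: spec[of _ i])
    qed (use U' W' in auto)
    then show "\<exists>s'. P (Suc k) s' \<and> fst s' \<subseteq> fst s \<and> (\<forall>i. snd s' i \<subseteq> snd s i)"
      using U'(1) W'(1) by (intro exI[of _ "(U', W')"]) simp
  qed
  then obtain s where s: "\<And>k. P k (s k)" "\<And>k. fst (s (Suc k)) \<subseteq> fst (s k)"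
      "\<And>k i. snd (s (Suc k)) i \<subseteq> snd (s k) i" by blast
  define U W where "U k = fst (s k)" and "W i k = snd (s k) i" for k i
  have dec: "U (Suc k) \<subseteq> U k" "W i (Suc k) \<subseteq> W i k" for i k
    using s(2,3) by (simp_all add: U_def W_def)
  have small: "x \<in> U (Suc k) \<Longrightarrow> y \<in> U (Suc k) \<Longrightarrow> dist x y \<le> 1 / real (Suc k)"
      "i < m \<Longrightarrow> x' \<in> W i (Suc k) \<Longrightarrow> y' \<in> W i (Suc k) \<Longrightarrow> dist x' y' \<le> 1 / real (Suc k)"
    for x y x' y' i k
    using s(1)[of "Suc k"] unfolding P_def U_def W_def by blast+
  have nsep: "\<not> separated F m (U k) (\<lambda>i. \<xi> ` W i k)" for k
    using s(1)[of k] by (simp add: P_def U_def W_def)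
  have "U k \<noteq> {}" for k
    using nsep[of k] separatedI[of m "\<lambda>_. UNIV" "\<lambda>i. \<xi> ` W i k" "U k" F] by auto
  then have "\<forall>k. \<exists>x. x \<in> U k" by blast
  from choice[OF this] obtain u where u: "\<And>k. u k \<in> U k" by blast
  have "W i k \<noteq> {}" if "i < m" for i k
  proof
    assume "W i k = {}"
    then have "separated F m (U k) (\<lambda>i. \<xi> ` W i k)"
      using that by (intro separatedI[of m "\<lambda>j. if j = i then {} else UNIV"]) (auto intro!: exI[of _ i])
    with nsep show False by blast
  qed
  then have "\<exists>w. \<forall>k. w k \<in> W i k" if "i < m" for i using that by (intro choice) blast
  then have "\<forall>i. \<exists>w. i < m \<longrightarrow> (\<forall>k. w k \<in> W i k)" by blast
  from choice[OF this] obtain w where w: "\<And>i k. i < m \<Longrightarrow> w i k \<in> W i k" by blast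
  obtain u' where u': "u \<longlonglongrightarrow> u'" "\<And>k x. x \<in> U (Suc k) \<Longrightarrow> dist x u' \<le> 1 / real (Suc k)"
    using shrinking_sets_limit[of U u, OF dec(1) small(1) u] by blast
  have "\<exists>w'. w i \<longlonglongrightarrow> w' \<and> (\<forall>k. \<forall>x\<in>W i (Suc k). dist x w' \<le> 1 / real (Suc k))" if "i < m" for i
    using shrinking_sets_limit[of "W i" "w i", OF dec(2) small(2)[OF that] w[OF that]] .
  then have "\<forall>i. \<exists>w'. i < m \<longrightarrow> w i \<longlonglongrightarrow> w' \<and> (\<forall>k. \<forall>x\<in>W i (Suc k). dist x w' \<le> 1 / real (Suc k))"
    by blast
  from choice[OF this] obtain w' where w': "\<And>i. i < m \<Longrightarrow> w i \<longlonglongrightarrow> w' i"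
      "\<And>i k x. i < m \<Longrightarrow> x \<in> W i (Suc k) \<Longrightarrow> dist x (w' i) \<le> 1 / real (Suc k)" by blast
  have w'D: "w' i \<in> D" if "i < m" for i
  proof (rule closed_sequentially[OF D _ w'(1)[OF that]])
    show "w i k \<in> D" for k using w[OF that, of k] s(1)[of k] by (auto simp: P_def W_def)
  qed
  show False
  proof (cases "fst (F u') = enat m")
    case False
    \<comment> \<open>Lengths are locally constant, so near \<open>u'\<close> there is no edge of
      length \<open>m\<close> and any box will do.\<close>
    have "open {y. fst (F y) = fst (F u')}" by (rule open_seq_space_length[OF F])
    then obtain e where e: "e > 0" "ball u' e \<subseteq> {y. fst (F y) = fst (F u')}"
      unfolding open_contains_ball by blast
    obtain k where "1 / real (Suc k) < e" using e(1) by (rule nat_approx_posE)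
    then have "U (Suc k) \<subseteq> ball u' e" using u'(2)[of _ k] by (force simp: dist_commute)
    then have "separated F m (U (Suc k)) (\<lambda>i. \<xi> ` W i (Suc k))"
      using False e(2) by (intro separatedI[of m "\<lambda>_. UNIV"]) auto
    with nsep show False by blast
  next
    case True
    then obtain i where i: "i < m" "snd (F u') i \<noteq> \<xi> (w' i)"
      using no_edge[OF True] w'D by auto
    then obtain S T where ST: "open S" "open T" "snd (F u') i \<in> S" "\<xi> (w' i) \<in> T" "S \<inter> T = {}"
      using hausdorff by metis
    have "open {y. fst (F y) = enat m \<and> snd (F y) i \<in> S}"
      using open_seq_space_coordinate[OF F ST(1)] i(1) by simp
    then obtain e1 where e1: "e1 > 0" "ball u' e1 \<subseteq> {y. fst (F y) = enat m \<and> snd (F y) i \<in> S}"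
      using True ST(3) unfolding open_contains_ball by blast
    have "open (\<xi> -` T)" using ST(2) \<xi> by (rule open_vimage)
    then obtain e2 where e2: "e2 > 0" "ball (w' i) e2 \<subseteq> \<xi> -` T"
      using ST(4) unfolding open_contains_ball by blast
    obtain k where k: "1 / real (Suc k) < min e1 e2" 
      using nat_approx_posE[of "min e1 e2"] e1(1) e2(1) by auto
    have "U (Suc k) \<subseteq> ball u' e1" using u'(2)[of _ k] k by (force simp: dist_commute)
    moreover have "W i (Suc k) \<subseteq> ball (w' i) e2" using w'(2)[OF i(1), of _ k] k by (force simp: dist_commute)
    ultimately have "separated F m (U (Suc k)) (\<lambda>i. \<xi> ` W i (Suc k))"
      using e1(2) e2(2) ST(2,5) i(1)
      by (intro separatedI[of m "\<lambda>j. if j = i then T else UNIV"]) (auto intro!: exI[of _ i])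
    with nsep show False by blast
  qed
qed

text \<open>The first reflection theorem for the statement that an analytic set is an anticlique,
  obtained as an \<open>m\<close>-dimensional version of Lusin's separation theorem for each length \<open>m\<close>
  of an edge.\<close>

lemma anticlique_borel_hull:
  fixes F :: "(nat \<Rightarrow> nat) \<Rightarrow> enat \<times> (nat \<Rightarrow> 'a::polish_space)"
    and \<xi> :: "'q::polish_space \<Rightarrow> 'a"
  assumes F: "continuous_map euclidean seq_space F" and \<xi>: "continuous_on UNIV \<xi>" and D: "closed D"
    and n: "arity_le n (range F)" and A: "anticlique (range F) (\<xi> ` D)"
  obtains B where "B \<in> sets borel" "\<xi> ` D \<subseteq> B" "anticlique (range F) B"
proof -
  have "separated F m UNIV (\<lambda>_. \<xi> ` D)" for m
  proof (rule separated_image[OF F \<xi> D])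
    fix y assume m: "fst (F y) = enat m"
    have "F y \<notin> seqs (\<xi> ` D)" using A by (auto simp: anticlique_def)
    with seq_space_range[OF F, of y] m show "\<exists>i<m. snd (F y) i \<notin> \<xi> ` D"
      by (cases "F y") (auto simp: seqs_def PiE_iff)
  qed
  then have "\<forall>m. \<exists>B. (\<forall>i<m. B i \<in> sets borel \<and> \<xi> ` D \<subseteq> B i) \<and>
     (\<forall>y. fst (F y) = enat m \<longrightarrow> (\<exists>i<m. snd (F y) i \<notin> B i))"
    by (simp add: separated_def)
  from choice[OF this] obtain B where
    "\<forall>m. (\<forall>i<m. B m i \<in> sets borel \<and> \<xi> ` D \<subseteq> B m i) \<and>
     (\<forall>y. fst (F y) = enat m \<longrightarrow> (\<exists>i<m. snd (F y) i \<notin> B m i))" ..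
  then have B: "\<And>m i. i < m \<Longrightarrow> B m i \<in> sets borel" "\<And>m i. i < m \<Longrightarrow> \<xi> ` D \<subseteq> B m i"
      "\<And>m y. fst (F y) = enat m \<Longrightarrow> \<exists>i<m. snd (F y) i \<notin> B m i"
    by simp_all
  \<comment> \<open>The arity bound makes every edge finite, so an edge in \<open>seqs C\<close>
    would lie in the box for its own length.\<close>
  define C where "C = (\<Inter>m. \<Inter>i. if i < m then B m i else UNIV)"
  show thesis
  proof (rule that)
    show "C \<in> sets borel"
      unfolding C_def by (intro sets.countable_INT image_subsetI) (simp_all add: B(1))
    show "\<xi> ` D \<subseteq> C" unfolding C_def using B(2) by (auto split: if_splits)
    have "F y \<notin> seqs C" for y
    proof
      assume y: "F y \<in> seqs C"
      have "fst (F y) \<le> enat n" 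
        using bspec[OF n[unfolded arity_le_def] rangeI[of F y]] by (simp add: case_prod_unfold)
      then obtain m where m: "fst (F y) = enat m" using enat_ile by blast
      obtain i where i: "i < m" "snd (F y) i \<notin> B m i" using B(3)[OF m] by blast
      have "snd (F y) i \<in> C" using y m i(1) by (cases "F y") (auto simp: seqs_def PiE_iff)
      with i show False by (auto simp: C_def)
    qed
    then show "anticlique (range F) C" by (auto simp: anticlique_def)
  qed
qed

section \<open>Configurations\<close>

text \<open>In a configuration of stage \<open>k\<close> only the nodes of length at most \<open>k\<close> matter. A node of
  length \<open>k\<close> carries a point and a witness for its membership in the given Borel set. The third
  component at a node \<open>r\<close> of length less than \<open>k\<close> is a witness for the edge at the nodes
  \<open>s j @ [i] @ r\<close>, where \<open>j + 1 + length r = k\<close>. With this indexing the \<open>i\<close>-th of the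
  configurations that were amalgamated last is obtained by appending \<open>i\<close> to all nodes.\<close>

type_synonym 'a config = "nat list \<Rightarrow> 'a \<times> (nat \<Rightarrow> nat) \<times> (nat \<Rightarrow> nat)"

abbreviation (input) pt :: "'a \<times> (nat \<Rightarrow> nat) \<times> (nat \<Rightarrow> nat) \<Rightarrow> 'a" where
  "pt v \<equiv> fst v"

abbreviation (input) wit :: "'a \<times> (nat \<Rightarrow> nat) \<times> (nat \<Rightarrow> nat) \<Rightarrow> nat \<Rightarrow> nat" where
  "wit v \<equiv> fst (snd v)"

abbreviation (input) edg :: "'a \<times> (nat \<Rightarrow> nat) \<times> (nat \<Rightarrow> nat) \<Rightarrow> nat \<Rightarrow> nat" where
  "edg v \<equiv> snd (snd v)"

definition nodes :: "nat \<Rightarrow> nat \<Rightarrow> nat list set" where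
  "nodes n k = {t. set t \<subseteq> {..<n} \<and> length t = k}"

lemma finite_nodes: "finite (nodes n k)"
  unfolding nodes_def by (rule finite_lists_length_eq) simp

lemma nodes_0: "nodes n 0 = {[]}"
  by (auto simp: nodes_def)

lemma nodes_snoc: "t @ [i] \<in> nodes n (Suc k) \<longleftrightarrow> t \<in> nodes n k \<and> i < n"
  by (auto simp: nodes_def)

lemma nodes_SucE:
  assumes "t \<in> nodes n (Suc k)"
  obtains u i where "t = u @ [i]" "u \<in> nodes n k" "i < n"
proof -
  have "t \<noteq> []" using assms by (auto simp: nodes_def)
  then have "t = butlast t @ [last t]" by simp
  with assms show thesis using that nodes_snoc by metis
qed

definition restr :: "nat \<Rightarrow> (nat list \<Rightarrow> 'b) \<Rightarrow> nat list \<Rightarrow> 'b" where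
  "restr i q = (\<lambda>t. q (t @ [i]))"

text \<open>The root is the one node not of the form \<open>t @ [i]\<close>; it is not inherited
  from the old configurations and can hold the new edge witness. For \<open>m \<le> n\<close>, only
  the first \<open>m\<close> of the \<open>n\<close> configurations meet the edge, and the others
  are arbitrary members of \<open>S\<close>.\<close>

definition amalgams ::
    "nat \<Rightarrow> ((nat \<Rightarrow> nat) \<Rightarrow> enat \<times> (nat \<Rightarrow> 'a)) \<Rightarrow> nat \<Rightarrow> nat list \<Rightarrow> 'a config set \<Rightarrow> 'a config set" where
  "amalgams n F m s S = {q. (\<forall>i<n. restr i q \<in> S) \<and> fst (F (edg (q []))) = enat m \<and>
     (\<forall>i<m. snd (F (edg (q []))) i = pt (q (s @ [i])))}"

text \<open>Smallness is tested at level \<open>k\<close> only. The negation provides, for each set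
  of the ideal, a configuration in \<open>S\<close> all of whose points at this level avoid
  it.\<close>

definition null_configs :: "'a::polish_space hypergraph set \<Rightarrow> nat \<Rightarrow> nat \<Rightarrow> 'a config set \<Rightarrow> bool" where
  "null_configs \<G> n k S \<longleftrightarrow>
     (\<exists>N\<in>hypergraph_ideal \<G>. \<forall>q\<in>S. \<exists>t\<in>nodes n k. pt (q t) \<in> N)"

lemma null_configs_UN:
  assumes "countable J" "\<And>c. c \<in> J \<Longrightarrow> null_configs \<G> n k (S c)" "S' \<subseteq> (\<Union>c\<in>J. S c)"
  shows "null_configs \<G> n k S'"
proof -
  have "\<forall>c\<in>J. \<exists>N. N \<in> hypergraph_ideal \<G> \<and> (\<forall>q\<in>S c. \<exists>t\<in>nodes n k. pt (q t) \<in> N)"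
    using assms(2) unfolding null_configs_def Bex_def by simp
  from bchoice[OF this] obtain N where
    N: "\<forall>c\<in>J. N c \<in> hypergraph_ideal \<G> \<and> (\<forall>q\<in>S c. \<exists>t\<in>nodes n k. pt (q t) \<in> N c)" ..
  have "(\<Union>c\<in>J. N c) \<in> hypergraph_ideal \<G>"
    using N by (intro hypergraph_ideal_UN assms(1)) blast
  moreover have "\<exists>t\<in>nodes n k. pt (q t) \<in> (\<Union>c\<in>J. N c)" if "q \<in> S'" for q
  proof -
    obtain c where c: "c \<in> J" "q \<in> S c" using assms(3) \<open>q \<in> S'\<close> by blast
    then obtain t where "t \<in> nodes n k" "pt (q t) \<in> N c" using N by blast
    with c(1) show ?thesis by blast
  qed
  ultimately show ?thesis unfolding null_configs_def by blast
qed

lemma tendsto_fun_coordinate: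
  fixes X :: "'b \<Rightarrow> 'i \<Rightarrow> 'c::topological_space"
  assumes "(X \<longlongrightarrow> l) A"
  shows "((\<lambda>k. X k t) \<longlongrightarrow> l t) A"
  by (rule continuous_on_tendsto_compose[OF continuous_on_product_coordinates assms]) simp_all

lemma continuous_on_restr: "continuous_on UNIV (restr i)"
  unfolding restr_def
  by (intro continuous_on_coordinatewise_then_product continuous_on_product_coordinates)

lemma closed_amalgams:
  assumes F: "continuous_map euclidean seq_space F" and S: "closed S"
  shows "closed (amalgams n F m s S :: 'a::polish_space config set)"
  unfolding closed_sequential_limits
proof (intro allI impI, elim conjE)
  fix q l assume q: "\<forall>k. q k \<in> amalgams n F m s S" and l: "q \<longlonglongrightarrow> l"
  have "restr i l \<in> S" if "i < n" for i
  proof (rule closed_sequentially[OF S])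
    show "restr i (q k) \<in> S" for k using q that by (simp add: amalgams_def)
    show "(\<lambda>k. restr i (q k)) \<longlonglongrightarrow> restr i l"
      by (rule continuous_on_tendsto_compose[OF continuous_on_restr l]) simp_all
  qed
  moreover have e: "(\<lambda>k. edg (q k [])) \<longlonglongrightarrow> edg (l [])"
    by (rule tendsto_snd[OF tendsto_snd[OF tendsto_fun_coordinate[OF l]]])
  have len: "fst (F (edg (q k []))) = enat m" for k using q by (simp add: amalgams_def)
  have "fst (F (edg (l []))) = enat m"
    by (rule seq_space_limit(1)[OF F e]) (rule len)
  moreover have "snd (F (edg (l []))) i = pt (l (s @ [i]))" if "i < m" for i
  proof (rule LIMSEQ_unique)
    show "(\<lambda>k. snd (F (edg (q k []))) i) \<longlonglongrightarrow> snd (F (edg (l []))) i"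
      by (rule seq_space_limit(2)[OF F e, of "enat m"]) (simp_all add: that len)
    have "(\<lambda>k. pt (q k (s @ [i]))) \<longlonglongrightarrow> pt (l (s @ [i]))"
      by (rule tendsto_fst[OF tendsto_fun_coordinate[OF l]])
    then show "(\<lambda>k. snd (F (edg (q k []))) i) \<longlonglongrightarrow> pt (l (s @ [i]))"
      using q that by (simp add: amalgams_def)
  qed
  ultimately show "l \<in> amalgams n F m s S" by (simp add: amalgams_def)
qed

text \<open>The length \<open>m\<close> is found by contradiction: the null sets for all
  \<open>m \<le> n\<close> are united and enlarged to a Borel set \<open>N\<close>. An edge among
  the points at \<open>s\<close> of configurations avoiding \<open>N\<close> would glue such
  configurations into an amalgam avoiding \<open>N\<close>. So these points form an anticlique, and
  its Borel hull together with \<open>N\<close> shows that \<open>S\<close> is null.\<close>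

lemma amalgams_not_null:
  fixes F :: "(nat \<Rightarrow> nat) \<Rightarrow> enat \<times> (nat \<Rightarrow> 'a::polish_space)"
  assumes F: "continuous_map euclidean seq_space F" "range F \<in> \<G>" "arity_le n (range F)"
    and nonempty: "\<And>y. fst (F y) \<noteq> 0"
    and s: "s \<in> nodes n k" and S: "closed S" "\<not> null_configs \<G> n k S"
  obtains m where "m \<le> n" "\<not> null_configs \<G> n (Suc k) (amalgams n F m s S)"
proof (rule ccontr)
  assume neg: "\<not> thesis"
  have "\<forall>m\<in>{..n}. \<exists>N. N \<in> hypergraph_ideal \<G> \<and> (\<forall>q\<in>amalgams n F m s S. \<exists>t\<in>nodes n (Suc k). pt (q t) \<in> N)"
  proof
    fix m assume "m \<in> {..n}"
    then have "null_configs \<G> n (Suc k) (amalgams n F m s S)"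
      using neg that by auto
    then show "\<exists>N. N \<in> hypergraph_ideal \<G> \<and> (\<forall>q\<in>amalgams n F m s S. \<exists>t\<in>nodes n (Suc k). pt (q t) \<in> N)"
      unfolding null_configs_def Bex_def .
  qed
  from bchoice[OF this] obtain N0 where N0: "\<forall>m\<in>{..n}. N0 m \<in> hypergraph_ideal \<G> \<and>
      (\<forall>q\<in>amalgams n F m s S. \<exists>t\<in>nodes n (Suc k). pt (q t) \<in> N0 m)" ..
  then have "(\<Union>m\<in>{..n}. N0 m) \<in> hypergraph_ideal \<G>"
    by (intro hypergraph_ideal_UN) auto
  then obtain N where N: "N \<in> hypergraph_ideal \<G>" "N \<in> sets borel" "(\<Union>m\<in>{..n}. N0 m) \<subseteq> N"
    by (rule hypergraph_ideal_borel_hull)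
  have "closed_projection (- N)"
    using borel_comp[OF N(2)] by (rule borel_closed_projection)
  then obtain C :: "('a \<times> (nat \<Rightarrow> nat)) set" where C: "closed C" "- N = fst ` C"
    unfolding closed_projection_def by blast
  \<comment> \<open>Each configuration is paired with witnesses that its points at level
    \<open>k\<close> lie outside \<open>N\<close>; this makes the set of avoiding configurations the
    projection of a closed set.\<close>
  define D where "D = {p :: 'a config \<times> (nat list \<Rightarrow> nat \<Rightarrow> nat).
    fst p \<in> S \<and> (\<forall>t\<in>nodes n k. (pt (fst p t), snd p t) \<in> C)}"
  define \<xi> where "\<xi> p = pt (fst p s)" for p :: "'a config \<times> (nat list \<Rightarrow> nat \<Rightarrow> nat)"
  have \<xi>: "continuous_on UNIV \<xi>"
    unfolding \<xi>_def
    by (rule continuous_on_fst[OF continuous_on_product_then_coordinatewise[OF continuous_on_fst[OF continuous_on_id]]])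
  have D: "closed D"
    unfolding closed_sequential_limits
  proof (intro allI impI, elim conjE)
    fix p l assume p: "\<forall>k. p k \<in> D" and l: "p \<longlonglongrightarrow> l"
    have "fst l \<in> S"
      by (rule closed_sequentially[OF S(1) _ tendsto_fst[OF l]]) (use p in \<open>simp add: D_def\<close>)
    moreover have "(pt (fst l t), snd l t) \<in> C" if "t \<in> nodes n k" for t
    proof (rule closed_sequentially[OF C(1)])
      show "(pt (fst (p k) t), snd (p k) t) \<in> C" for k using p that by (simp add: D_def)
      show "(\<lambda>k. (pt (fst (p k) t), snd (p k) t)) \<longlonglongrightarrow> (pt (fst l t), snd l t)"
        by (rule tendsto_Pair[OF tendsto_fst[OF tendsto_fun_coordinate[OF tendsto_fst[OF l]]]
              tendsto_fun_coordinate[OF tendsto_snd[OF l]]])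
    qed
    ultimately show "l \<in> D" by (simp add: D_def)
  qed
  have "anticlique (range F) (\<xi> ` D)"
    unfolding anticlique_def
  proof (rule ccontr)
    assume "seqs (\<xi> ` D) \<inter> range F \<noteq> {}"
    then obtain y where y: "F y \<in> seqs (\<xi> ` D)" by blast
    have "fst (F y) \<le> enat n"
      using bspec[OF F(3)[unfolded arity_le_def] rangeI[of F y]] by (simp add: case_prod_unfold)
    then obtain m where m: "fst (F y) = enat m" using enat_ile by blast
    with \<open>fst (F y) \<le> enat n\<close> nonempty[of y] have mn: "0 < m" "m \<le> n"
      by (auto simp: zero_enat_def)
    have "\<forall>i\<in>{..<m}. \<exists>p. p \<in> D \<and> snd (F y) i = \<xi> p"
    proof
      fix i assume "i \<in> {..<m}"
      then have "snd (F y) i \<in> \<xi> ` D"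
        using y m by (cases "F y") (auto simp: seqs_def PiE_iff)
      then show "\<exists>p. p \<in> D \<and> snd (F y) i = \<xi> p" by blast
    qed
    from bchoice[OF this] obtain p where "\<forall>i\<in>{..<m}. p i \<in> D \<and> snd (F y) i = \<xi> (p i)" ..
    then have p: "p i \<in> D" "snd (F y) i = \<xi> (p i)" if "i < m" for i using that by auto
    \<comment> \<open>If \<open>m < n\<close>, the surplus places of the amalgam are filled with
      copies of configuration 0, which is available because edges are nonempty.\<close>
    define c where "c i = (if i < m then i else 0)" for i
    have c: "c i < m" for i using mn by (simp add: c_def)
    \<comment> \<open>The root stores the edge witness \<open>y\<close> in its third entry. The
      other two entries are arbitrary, as the root is not a node of level
      \<open>Suc k\<close>.\<close>
    define q where "q t = (if t = [] then (pt (fst (p 0) []), y, y) else fst (p (c (last t))) (butlast t))"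
      for t
    have restr_q: "restr i q = fst (p (c i))" for i
      by (rule ext) (simp add: restr_def q_def)
    have "q \<in> amalgams n F m s S"
      unfolding amalgams_def mem_Collect_eq
    proof (intro conjI allI impI)
      show "restr i q \<in> S" for i
        using p(1)[OF c[of i]] by (simp add: restr_q D_def)
      show "fst (F (edg (q []))) = enat m" using m by (simp add: q_def)
      show "snd (F (edg (q []))) i = pt (q (s @ [i]))" if "i < m" for i
        using p(2)[OF that] that by (simp add: q_def \<xi>_def c_def)
    qed
    then obtain t where t: "t \<in> nodes n (Suc k)" "pt (q t) \<in> N0 m"
      using N0 mn(2) by blast
    then obtain u i where u: "t = u @ [i]" "u \<in> nodes n k" by (auto elim: nodes_SucE)
    have "pt (q t) \<in> N" using t(2) N(3) mn(2) by auto
    moreover have "(pt (q t), snd (p (c i)) u) \<in> C"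
      using p(1)[OF c[of i]] u by (simp add: D_def q_def)
    ultimately show False using C(2) by (metis ComplD fst_conv image_eqI)
  qed
  then obtain B where B: "B \<in> sets borel" "\<xi> ` D \<subseteq> B" "anticlique (range F) B"
    by (rule anticlique_borel_hull[OF F(1) \<xi> D F(3)])
  have "N \<union> B \<in> hypergraph_ideal \<G>"
    using N(1) anticlique_in_hypergraph_ideal[OF B(1) F(2) B(3)] by (rule hypergraph_ideal_Un)
  moreover have "\<exists>t\<in>nodes n k. pt (q t) \<in> N \<union> B" if "q \<in> S" for q
  proof (cases "\<exists>t\<in>nodes n k. pt (q t) \<in> N")
    case False
    then have "\<forall>t\<in>nodes n k. \<exists>u. (pt (q t), u) \<in> C"
      using C(2) by (metis ComplI imageE prod.collapse)
    from bchoice[OF this] obtain u where "\<forall>t\<in>nodes n k. (pt (q t), u t) \<in> C" ..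
    then have "(q, u) \<in> D" using that by (simp add: D_def)
    then have "pt (q s) \<in> B" using B(2) by (auto simp: \<xi>_def)
    then show ?thesis using s by blast
  qed blast
  ultimately have "null_configs \<G> n k S" unfolding null_configs_def by blast
  with S(2) show False ..
qed

lemma null_configs_cover:
  fixes K :: "'c::countable \<Rightarrow> 'a::polish_space config set"
  assumes "closed S" "\<not> null_configs \<G> n k S" "\<And>c. closed (K c)" "S \<subseteq> (\<Union>c. K c)"
  obtains c where "closed (S \<inter> K c)" "\<not> null_configs \<G> n k (S \<inter> K c)"
proof -
  have "S \<subseteq> (\<Union>c. S \<inter> K c)" using assms(4) by blast
  then obtain c where "\<not> null_configs \<G> n k (S \<inter> K c)"
    using assms(2) null_configs_UN[of UNIV \<G> n k "\<lambda>c. S \<inter> K c" S] by auto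
  then show thesis using that assms(1,3) by (simp add: closed_Int)
qed

text \<open>The requirements pass to subsets, so meeting a further one never undoes the earlier
  ones.\<close>

lemma null_configs_refine:
  assumes "finite J" "closed S" "\<not> null_configs \<G> n k S"
    and step: "\<And>j S. j \<in> J \<Longrightarrow> closed S \<Longrightarrow> \<not> null_configs \<G> n k S \<Longrightarrow>
      \<exists>S'\<subseteq>S. closed S' \<and> \<not> null_configs \<G> n k S' \<and> \<Phi> j S'"
    and anti: "\<And>j S S'. S' \<subseteq> S \<Longrightarrow> \<Phi> j S \<Longrightarrow> \<Phi> j S'"
  shows "\<exists>S'\<subseteq>S. closed S' \<and> \<not> null_configs \<G> n k S' \<and> (\<forall>j\<in>J. \<Phi> j S')"
  using assms(1) step
proof (induction J)
  case empty
  show ?case using assms(2,3) by (intro exI[of _ S]) simp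
next
  case (insert j J)
  from insert.IH insert.prems obtain S1 where S1: "S1 \<subseteq> S" "closed S1"
      "\<not> null_configs \<G> n k S1" "\<forall>i\<in>J. \<Phi> i S1"
    by auto
  from insert.prems[OF insertI1 S1(2,3)] obtain S2 where S2: "S2 \<subseteq> S1" "closed S2"
      "\<not> null_configs \<G> n k S2" "\<Phi> j S2"
    by blast
  have "\<forall>i\<in>insert j J. \<Phi> i S2" using S2(1,4) S1(4) anti by blast
  then show ?case using S1(1) S2 by (intro exI[of _ S2]) (simp add: subset_trans)
qed

text \<open>The coordinates of a witness at which the coding of \<open>closed_projection_scheme\<close> stores the
  indices \<open>j\<close>.\<close>

definition coded_value :: "'a \<times> (nat \<Rightarrow> nat) \<times> (nat \<Rightarrow> nat) \<Rightarrow> nat \<Rightarrow> nat" where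
  "coded_value v i = wit v (prod_encode (i, 0))"

lemma continuous_coded_value: "continuous_on UNIV (\<lambda>q :: 'a::topological_space config. coded_value (q t) i)"
  unfolding coded_value_def
  by (rule continuous_on_product_then_coordinatewise[OF continuous_on_fst[OF continuous_on_snd[OF
        continuous_on_product_coordinates]]])

lemma closed_coded_value_eq: "closed {q :: 'a::topological_space config. coded_value (q t) i = c}"
  by (intro closed_Collect_eq continuous_coded_value continuous_on_const)

text \<open>The distance clause includes nodes shorter than \<open>k\<close> because these hold edge
  witnesses, which have to converge too. The last clause yields the branching bound: if the values
  at two nodes agree below \<open>l\<close> throughout \<open>S\<close>, they agree for
  ever.\<close>

definition settled :: "nat \<Rightarrow> nat \<Rightarrow> nat \<Rightarrow> 'a::metric_space config set \<Rightarrow> bool" where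
  "settled n k l S \<longleftrightarrow>
     (\<forall>t. length t \<le> k \<longrightarrow> set t \<subseteq> {..<n} \<longrightarrow> (\<forall>q\<in>S. \<forall>q'\<in>S. dist (q t) (q' t) \<le> 1 / real (Suc k))) \<and>
     (\<forall>t\<in>nodes n k. \<forall>i<l. \<forall>q\<in>S. \<forall>q'\<in>S. coded_value (q t) i = coded_value (q' t) i) \<and>
     (\<forall>t\<in>nodes n k. \<forall>t'\<in>nodes n k. (\<forall>q\<in>S. \<forall>i<l. coded_value (q t) i = coded_value (q t') i) \<longrightarrow> (\<forall>q\<in>S. coded_value (q t) = coded_value (q t')))"

lemma settle_dist:
  fixes S :: "'a::polish_space config set"
  assumes S: "closed S" "\<not> null_configs \<G> n k S" and e: "e > 0"
  shows "\<exists>S'\<subseteq>S. closed S' \<and> \<not> null_configs \<G> n k S' \<and> (\<forall>q\<in>S'. \<forall>q'\<in>S'. dist (q t) (q' t) \<le> e)"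
proof -
  obtain d :: "nat \<Rightarrow> 'a \<times> (nat \<Rightarrow> nat) \<times> (nat \<Rightarrow> nat)"
    where d: "\<And>x e. e > 0 \<Longrightarrow> \<exists>i. dist x (d i) < e"
    by (rule dense_sequence) blast
  define K where "K c = {q :: 'a config. dist (q t) (d c) \<le> e / 2}" for c
  obtain c where c: "closed (S \<inter> K c)" "\<not> null_configs \<G> n k (S \<inter> K c)"
  proof (rule null_configs_cover[OF S])
    show "closed (K c)" for c
      unfolding K_def
      by (intro closed_Collect_le continuous_on_const continuous_on_dist continuous_on_product_coordinates)
    have "q \<in> (\<Union>c. K c)" for q
      using d[of "e / 2" "q t"] e unfolding K_def by (auto intro: less_imp_le)
    then show "S \<subseteq> (\<Union>c. K c)" by blast
  qed
  have "dist (q t) (q' t) \<le> e" if "q \<in> K c" "q' \<in> K c" for q q'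
    using that dist_triangle2[of "q t" "q' t" "d c"] by (simp add: K_def)
  then show ?thesis using c by (intro exI[of _ "S \<inter> K c"]) simp
qed

lemma settle_value:
  fixes S :: "'a::polish_space config set"
  assumes S: "closed S" "\<not> null_configs \<G> n k S"
  shows "\<exists>S'\<subseteq>S. closed S' \<and> \<not> null_configs \<G> n k S' \<and> (\<forall>q\<in>S'. \<forall>q'\<in>S'. coded_value (q t) i = coded_value (q' t) i)"
proof -
  obtain c where c: "closed (S \<inter> {q. coded_value (q t) i = c})" "\<not> null_configs \<G> n k (S \<inter> {q. coded_value (q t) i = c})"
    by (rule null_configs_cover[OF S, of "\<lambda>c. {q. coded_value (q t) i = c}"]) (simp_all add: closed_coded_value_eq, blast)
  then show ?thesis by (intro exI[of _ "S \<inter> {q. coded_value (q t) i = c}"]) simp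
qed

lemma settle_pair:
  fixes S :: "'a::polish_space config set"
  assumes S: "closed S" "\<not> null_configs \<G> n k S"
  shows "\<exists>S'\<subseteq>S. closed S' \<and> \<not> null_configs \<G> n k S' \<and>
    ((\<forall>q\<in>S'. coded_value (q t) = coded_value (q t')) \<or> (\<exists>i. \<forall>q\<in>S'. coded_value (q t) i \<noteq> coded_value (q t') i))"
proof -
  \<comment> \<open>Disagreement is split by its place \<open>i\<close> and the two values there,
    which leaves countably many closed pieces.\<close>
  define K where "K c = (case c of None \<Rightarrow> {q :: 'a config. \<forall>i. coded_value (q t) i = coded_value (q t') i}
      | Some (i, a, b) \<Rightarrow> {q. a \<noteq> b \<and> coded_value (q t) i = a \<and> coded_value (q t') i = b})"
    for c :: "(nat \<times> nat \<times> nat) option"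
  obtain c where c: "closed (S \<inter> K c)" "\<not> null_configs \<G> n k (S \<inter> K c)"
  proof (rule null_configs_cover[OF S])
    show "closed (K c)" for c
      unfolding K_def
      by (auto split: option.splits intro!: closed_Collect_conj closed_coded_value_eq closed_Collect_all
          closed_Collect_eq continuous_coded_value)
    have "q \<in> (\<Union>c. K c)" for q
    proof (cases "\<forall>i. coded_value (q t) i = coded_value (q t') i")
      case True
      then have "q \<in> K None" by (simp add: K_def)
      then show ?thesis by blast
    next
      case False
      then obtain i where "coded_value (q t) i \<noteq> coded_value (q t') i" by blast
      then have "q \<in> K (Some (i, coded_value (q t) i, coded_value (q t') i))" by (simp add: K_def)
      then show ?thesis by blast
    qed
    then show "S \<subseteq> (\<Union>c. K c)" by blast
  qed
  have "(\<forall>q\<in>S \<inter> K c. coded_value (q t) = coded_value (q t')) \<or> (\<exists>i. \<forall>q\<in>S \<inter> K c. coded_value (q t) i \<noteq> coded_value (q t') i)"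
  proof (cases c)
    case None
    then show ?thesis by (auto simp: K_def)
  next
    case (Some p)
    then have "\<forall>q\<in>S \<inter> K c. coded_value (q t) (fst p) \<noteq> coded_value (q t') (fst p)"
      by (cases p) (auto simp: K_def)
    then show ?thesis by blast
  qed
  then show ?thesis using c by (intro exI[of _ "S \<inter> K c"]) simp
qed

text \<open>Pairs of nodes are treated before \<open>l\<close> is chosen, because \<open>l\<close>
  has to exceed a place of disagreement for each pair that disagrees. The values below
  \<open>l\<close> are fixed last.\<close>

lemma settle:
  fixes S :: "'a::polish_space config set"
  assumes S: "closed S" "\<not> null_configs \<G> n k S"
  obtains S' l where "S' \<subseteq> S" "closed S'" "\<not> null_configs \<G> n k S'" "l \<ge> l0" "settled n k l S'"
proof -
  let ?T = "{t. set t \<subseteq> {..<n} \<and> length t \<le> k}"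
  have "\<exists>S'\<subseteq>S. closed S' \<and> \<not> null_configs \<G> n k S' \<and>
      (\<forall>t\<in>?T. \<forall>q\<in>S'. \<forall>q'\<in>S'. dist (q t) (q' t) \<le> 1 / real (Suc k))"
  proof (rule null_configs_refine[OF _ S])
    show "finite ?T" by (rule finite_lists_length_le) simp
    show "\<exists>S'\<subseteq>S. closed S' \<and> \<not> null_configs \<G> n k S' \<and>
        (\<forall>q\<in>S'. \<forall>q'\<in>S'. dist (q t) (q' t) \<le> 1 / real (Suc k))"
      if "closed S" "\<not> null_configs \<G> n k S" for t and S :: "'a config set"
      using settle_dist[OF that, of "1 / real (Suc k)" t] by simp
  qed blast
  then obtain S1 where S1: "S1 \<subseteq> S" "closed S1" "\<not> null_configs \<G> n k S1"
      "\<forall>t\<in>?T. \<forall>q\<in>S1. \<forall>q'\<in>S1. dist (q t) (q' t) \<le> 1 / real (Suc k)" by blast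
  let ?\<Phi> = "\<lambda>p S'. (\<forall>q\<in>S'. coded_value (q (fst p)) = coded_value (q (snd p))) \<or>
        (\<exists>i. \<forall>q\<in>S'. coded_value (q (fst p)) i \<noteq> coded_value (q (snd p)) i)"
  have "\<exists>S'\<subseteq>S1. closed S' \<and> \<not> null_configs \<G> n k S' \<and> (\<forall>p\<in>nodes n k \<times> nodes n k. ?\<Phi> p S')"
  proof (rule null_configs_refine[OF _ S1(2,3)])
    show "\<exists>S'\<subseteq>S. closed S' \<and> \<not> null_configs \<G> n k S' \<and> ?\<Phi> p S'"
      if "closed S" "\<not> null_configs \<G> n k S" for p and S :: "'a config set"
      by (rule settle_pair[OF that])
  qed (blast | simp add: finite_nodes)+
  then obtain S2 where S2: "S2 \<subseteq> S1" "closed S2" "\<not> null_configs \<G> n k S2"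
      "\<forall>p\<in>nodes n k \<times> nodes n k. ?\<Phi> p S2" by blast
  have "\<forall>p\<in>nodes n k \<times> nodes n k. \<exists>i. (\<forall>q\<in>S2. coded_value (q (fst p)) = coded_value (q (snd p))) \<or>
      (\<forall>q\<in>S2. coded_value (q (fst p)) i \<noteq> coded_value (q (snd p)) i)"
    using S2(4) by blast
  from bchoice[OF this] obtain f where f: "\<forall>p\<in>nodes n k \<times> nodes n k.
      (\<forall>q\<in>S2. coded_value (q (fst p)) = coded_value (q (snd p))) \<or> (\<forall>q\<in>S2. coded_value (q (fst p)) (f p) \<noteq> coded_value (q (snd p)) (f p))" ..
  have "finite (f ` (nodes n k \<times> nodes n k))" by (simp add: finite_nodes)
  then obtain l1 where l1: "\<And>p. p \<in> nodes n k \<times> nodes n k \<Longrightarrow> f p < l1"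
    using finite_nat_set_iff_bounded by (metis imageI)
  define l where "l = max l0 l1"
  have "\<exists>S'\<subseteq>S2. closed S' \<and> \<not> null_configs \<G> n k S' \<and>
      (\<forall>p\<in>nodes n k \<times> {..<l}. \<forall>q\<in>S'. \<forall>q'\<in>S'. coded_value (q (fst p)) (snd p) = coded_value (q' (fst p)) (snd p))"
  proof (rule null_configs_refine[OF _ S2(2,3)])
    show "\<exists>S'\<subseteq>S. closed S' \<and> \<not> null_configs \<G> n k S' \<and>
        (\<forall>q\<in>S'. \<forall>q'\<in>S'. coded_value (q (fst p)) (snd p) = coded_value (q' (fst p)) (snd p))"
      if "closed S" "\<not> null_configs \<G> n k S" for p and S :: "'a config set"
      by (rule settle_value[OF that])
  qed (blast | simp add: finite_nodes)+
  then obtain S3 where S3: "S3 \<subseteq> S2" "closed S3" "\<not> null_configs \<G> n k S3"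
      "\<forall>p\<in>nodes n k \<times> {..<l}. \<forall>q\<in>S3. \<forall>q'\<in>S3. coded_value (q (fst p)) (snd p) = coded_value (q' (fst p)) (snd p)"
    by blast
  have "S3 \<noteq> {}"
    using S3(3) hypergraph_ideal_empty unfolding null_configs_def by auto
  have "settled n k l S3"
    unfolding settled_def
  proof (intro conjI allI ballI impI)
    show "dist (q t) (q' t) \<le> 1 / real (Suc k)"
      if "length t \<le> k" "set t \<subseteq> {..<n}" "q \<in> S3" "q' \<in> S3" for t q q'
      using that S1(4) S2(1) S3(1) by blast
    show "coded_value (q t) i = coded_value (q' t) i" if "t \<in> nodes n k" "i < l" "q \<in> S3" "q' \<in> S3" for t i q q'
      using S3(4) that by (metis SigmaI fst_conv lessThan_iff snd_conv)
    show "coded_value (q t) = coded_value (q t')" if t: "t \<in> nodes n k" "t' \<in> nodes n k" and q: "q \<in> S3"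
      and eq: "\<forall>q\<in>S3. \<forall>i<l. coded_value (q t) i = coded_value (q t') i" for t t' q
    proof -
      have "f (t, t') < l" using l1[of "(t, t')"] t by (simp add: l_def)
      then have "coded_value (q t) (f (t, t')) = coded_value (q t') (f (t, t'))" using eq q by blast
      then show ?thesis using bspec[OF f, of "(t, t')"] t q S3(1) by auto
    qed
  qed
  moreover have "l \<ge> l0" by (simp add: l_def)
  moreover have "S3 \<subseteq> S" using S1(1) S2(1) S3(1) by blast
  ultimately show thesis using that S3(2,3) by blast
qed

section \<open>Fusion\<close>

definition initial :: "(nat \<Rightarrow> nat) \<Rightarrow> nat \<Rightarrow> nat list" where
  "initial b k = map b [0..<k]"

definition cat :: "nat list \<Rightarrow> (nat \<Rightarrow> nat) \<Rightarrow> nat \<Rightarrow> nat" where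
  "cat u z = (\<lambda>j. if j < length u then u ! j else z (j - length u))"

lemma initial_Suc: "initial b (Suc k) = initial b k @ [b k]"
  by (simp add: initial_def)

lemma length_initial [simp]: "length (initial b k) = k"
  by (simp add: initial_def)

lemma initial_0 [simp]: "initial b 0 = []"
  by (simp add: initial_def)

lemma initial_cat: "initial (cat u z) (length u + j) = u @ initial z j"
  by (rule nth_equalityI) (auto simp: initial_def cat_def nth_append)

lemma initial_eqI: "(\<And>i. i < k \<Longrightarrow> b i = b' i) \<Longrightarrow> initial b k = initial b' k"
  by (simp add: initial_def)

lemma initial_nodes: "\<forall>i. b i < n \<Longrightarrow> initial b k \<in> nodes n k"
  by (auto simp: initial_def nodes_def)

lemma set_initial: "\<forall>i. b i < n \<Longrightarrow> set (initial b k) \<subseteq> {..<n}"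
  by (auto simp: initial_def)

lemma continuous_on_cat: "continuous_on UNIV (cat u)"
proof -
  have "continuous_on UNIV (\<lambda>z :: nat \<Rightarrow> nat. if j < length u then u ! j else z (j - length u))" for j
    by (cases "j < length u") (simp_all add: continuous_on_product_coordinates)
  then show ?thesis
    unfolding cat_def by (intro continuous_on_coordinatewise_then_product)
qed

lemma open_cat:
  assumes "open U"
  shows "open (cat u ` U)"
  unfolding open_nat_fun_iff
proof
  fix b assume "b \<in> cat u ` U"
  then obtain z where z: "z \<in> U" "b = cat u z" by blast
  then obtain k where k: "\<And>z'. (\<forall>i<k. z' i = z i) \<Longrightarrow> z' \<in> U"
    using assms unfolding open_nat_fun_iff by blast
  have "b' \<in> cat u ` U" if eq: "\<forall>i<length u + k. b' i = b i" for b'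
  proof -
    define z' where "z' j = b' (length u + j)" for j
    have "z' \<in> U" by (rule k) (simp add: z'_def eq z(2) cat_def)
    moreover have "b' = cat u z'"
      by (rule ext) (use eq in \<open>simp add: z(2) cat_def z'_def\<close>)
    ultimately show ?thesis by blast
  qed
  then show "\<exists>k. \<forall>b'. (\<forall>i<k. b' i = b i) \<longrightarrow> b' \<in> cat u ` U" by blast
qed

lemma settled_dist:
  assumes "settled n k l S" "length t \<le> k" "set t \<subseteq> {..<n}" "q \<in> S" "q' \<in> S"
  shows "dist (q t) (q' t) \<le> 1 / real (Suc k)"
  using conjunct1[OF assms(1)[unfolded settled_def], rule_format, OF assms(2-5)] .

lemma settled_value:
  assumes "settled n k l S" "t \<in> nodes n k" "i < l" "q \<in> S" "q' \<in> S"
  shows "coded_value (q t) i = coded_value (q' t) i"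
  using conjunct1[OF conjunct2[OF assms(1)[unfolded settled_def]], rule_format, OF assms(2-5)] .

lemma settled_eq:
  assumes "settled n k l S" "t \<in> nodes n k" "t' \<in> nodes n k"
    "\<And>q i. q \<in> S \<Longrightarrow> i < l \<Longrightarrow> coded_value (q t) i = coded_value (q t') i" "q \<in> S"
  shows "coded_value (q t) = coded_value (q t')"
  using conjunct2[OF conjunct2[OF assms(1)[unfolded settled_def]], rule_format, OF assms(2,3) _ assms(5)]
    assms(4) .

text \<open>Closedness and largeness of the sets \<open>S k\<close> steer the construction in
  \<open>fusion_exists\<close>; the passage to the limit works from the facts listed here. The
  strict growth of \<open>l\<close> ensures that every value is decided at some stage.\<close>

locale fusion =
  fixes n :: nat and C :: "('a::polish_space \<times> (nat \<Rightarrow> nat)) set"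
    and F :: "nat \<Rightarrow> (nat \<Rightarrow> nat) \<Rightarrow> enat \<times> (nat \<Rightarrow> 'a)"
    and s :: "nat \<Rightarrow> nat list" and S :: "nat \<Rightarrow> 'a config set" and l m :: "nat \<Rightarrow> nat"
  assumes n: "n \<ge> 1" and C: "closed C" and F: "\<And>k. continuous_map euclidean seq_space (F k)"
    and s: "\<And>k. s k \<in> nodes n k"
    and S_0: "\<And>q. q \<in> S 0 \<Longrightarrow> (pt (q []), wit (q [])) \<in> C"
    and S_Suc: "\<And>k. S (Suc k) \<subseteq> amalgams n (F k) (m k) (s k) (S k)"
    and S_nonempty: "\<And>k. S k \<noteq> {}"
    and settled: "\<And>k. settled n k (l k) (S k)"
    and l: "\<And>k. l k < l (Suc k)" and m: "\<And>k. m k \<le> n"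
begin

lemma strict_mono_l: "strict_mono l"
  by (simp add: strict_mono_Suc_iff l)

text \<open>Each letter of \<open>u\<close>, starting with the last one, undoes one
  amalgamation.\<close>

lemma S_suffix:
  "q \<in> S (k + j) \<Longrightarrow> set u \<subseteq> {..<n} \<Longrightarrow> length u = j \<Longrightarrow> (\<lambda>t. q (t @ u)) \<in> S k"
proof (induction j arbitrary: q u)
  case 0
  then show ?case by simp
next
  case (Suc j)
  then have "u \<noteq> []" by auto
  then obtain u' i where u: "u = u' @ [i]" by (metis append_butlast_last_id)
  have "q \<in> amalgams n (F (k + j)) (m (k + j)) (s (k + j)) (S (k + j))"
    using Suc.prems(1) S_Suc by auto
  then have "restr i q \<in> S (k + j)" using Suc.prems(2) by (simp add: amalgams_def u)
  from Suc.IH[OF this, of u'] Suc.prems(2,3) show ?case by (simp add: u restr_def)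
qed

section \<open>Limits along branches\<close>

definition Q :: "nat \<Rightarrow> 'a config" where "Q k = (SOME q. q \<in> S k)"

lemma Q: "Q k \<in> S k"
  using S_nonempty[of k] unfolding Q_def some_in_eq .

text \<open>The limit of the configurations along the branch \<open>z\<close>, where the node \<open>initial z j\<close> of a
  configuration of stage \<open>p + j\<close> is used. The case \<open>p = 0\<close> gives the points of the final copy of
  \<open>n\<^sup>\<omega>\<close>; other values of \<open>p\<close> give the witnesses for the edges.\<close>

definition branch_limit :: "nat \<Rightarrow> (nat \<Rightarrow> nat) \<Rightarrow> 'a \<times> (nat \<Rightarrow> nat) \<times> (nat \<Rightarrow> nat)" where
  "branch_limit p z = lim (\<lambda>j. Q (p + j) (initial z j))"

text \<open>Cutting off the last \<open>i\<close> letters with \<open>S_suffix\<close> shows that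
  the sets of values along \<open>z\<close> shrink as the stage grows, as
  \<open>shrinking_sets_limit\<close> requires.\<close>

lemma branch_antimono:
  assumes z: "\<forall>i. z i < n" and "q \<in> S (p + j + i)"
  shows "\<exists>q'\<in>S (p + j). q (initial z (j + i)) = q' (initial z j)"
proof -
  define u where "u = map z [j..<j + i]"
  have "(\<lambda>t. q (t @ u)) \<in> S (p + j)"
    by (rule S_suffix[OF assms(2)]) (auto simp: u_def z)
  moreover have "initial z (j + i) = initial z j @ u"
    unfolding initial_def u_def map_append[symmetric]
    using upt_add_eq_append[of 0 j i] by simp
  ultimately show ?thesis by (intro bexI[of _ "\<lambda>t. q (t @ u)"]) simp_all
qed

lemma branch_limit:
  assumes z: "\<forall>i. z i < n"
  shows "(\<lambda>j. Q (p + j) (initial z j)) \<longlonglongrightarrow> branch_limit p z"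
    and "q \<in> S (p + Suc j) \<Longrightarrow> dist (q (initial z (Suc j))) (branch_limit p z) \<le> 1 / real (Suc j)"
proof -
  define A where "A j = {q (initial z j) | q. q \<in> S (p + j)}" for j
  have "A (Suc j) \<subseteq> A j" for j
    using branch_antimono[OF z, of _ p j 1] by (fastforce simp: A_def)
  moreover have "dist x y \<le> 1 / real (Suc j)" if "x \<in> A (Suc j)" "y \<in> A (Suc j)" for j x y
  proof -
    obtain q q' where q: "q \<in> S (p + Suc j)" "q' \<in> S (p + Suc j)"
        "x = q (initial z (Suc j))" "y = q' (initial z (Suc j))"
      using \<open>x \<in> A (Suc j)\<close> \<open>y \<in> A (Suc j)\<close> unfolding A_def by blast
    have "dist x y \<le> 1 / real (Suc (p + Suc j))"
      unfolding q(3,4)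
      by (rule settled_dist[OF settled _ set_initial[OF z] q(1,2)]) simp
    also have "\<dots> \<le> 1 / real (Suc j)" by (intro divide_left_mono) auto
    finally show ?thesis .
  qed
  moreover have "Q (p + j) (initial z j) \<in> A j" for j using Q unfolding A_def by blast
  ultimately obtain v where v: "(\<lambda>j. Q (p + j) (initial z j)) \<longlonglongrightarrow> v"
      "\<forall>j. \<forall>x\<in>A (Suc j). dist x v \<le> 1 / real (Suc j)"
    using shrinking_sets_limit[of A "\<lambda>j. Q (p + j) (initial z j)"] by blast
  have eq: "branch_limit p z = v" unfolding branch_limit_def using v(1) by (rule limI)
  show "(\<lambda>j. Q (p + j) (initial z j)) \<longlonglongrightarrow> branch_limit p z" using v(1) eq by simp
  show "dist (q (initial z (Suc j))) (branch_limit p z) \<le> 1 / real (Suc j)" if "q \<in> S (p + Suc j)"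
    using v(2) that unfolding eq A_def by blast
qed

text \<open>By \<open>S_suffix\<close>, every node of level \<open>j\<close> in a configuration of
  stage \<open>j\<close> is the root of a configuration of stage 0, and \<open>C\<close> is
  closed.\<close>

lemma branch_limit_in_C:
  assumes b: "\<forall>i. b i < n"
  shows "(pt (branch_limit 0 b), wit (branch_limit 0 b)) \<in> C"
proof (rule closed_sequentially[OF C])
  show "(pt (Q j (initial b j)), wit (Q j (initial b j))) \<in> C" for j
    using S_0[OF S_suffix[of "Q j" 0 j "initial b j"]] Q[of j] set_initial[OF b, of j] by simp
  note lim = branch_limit(1)[OF b, of 0, unfolded add_0]
  show "(\<lambda>j. (pt (Q j (initial b j)), wit (Q j (initial b j))))
      \<longlonglongrightarrow> (pt (branch_limit 0 b), wit (branch_limit 0 b))"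
    by (rule tendsto_Pair[OF tendsto_fst[OF lim] tendsto_fst[OF tendsto_snd[OF lim]]])
qed

text \<open>By \<open>branch_antimono\<close> the values of later stages occur already in
  \<open>S k\<close>, where those below \<open>l k\<close> are fixed. So the approximating sequence
  is constant from \<open>k\<close> on.\<close>

lemma coded_value_branch_limit:
  assumes b: "\<forall>i. b i < n" and q: "q \<in> S k" and i: "i < l k"
  shows "coded_value (branch_limit 0 b) i = coded_value (q (initial b k)) i"
proof (rule LIMSEQ_unique)
  note lim = branch_limit(1)[OF b, of 0, unfolded add_0]
  show "(\<lambda>j. coded_value (Q j (initial b j)) i) \<longlonglongrightarrow> coded_value (branch_limit 0 b) i"
    unfolding coded_value_def by (rule tendsto_fun_coordinate[OF tendsto_fst[OF tendsto_snd[OF lim]]])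
  show "(\<lambda>j. coded_value (Q j (initial b j)) i) \<longlonglongrightarrow> coded_value (q (initial b k)) i"
  proof (intro tendsto_eventually eventually_sequentiallyI[of k])
    fix j assume "k \<le> j"
    then obtain d where d: "j = k + d" by (rule le_Suc_ex[THEN exE])
    obtain q' where q': "q' \<in> S k" "Q j (initial b j) = q' (initial b k)"
      using branch_antimono[OF b, of "Q j" 0 k d] Q[of j] by (auto simp: d)
    then show "coded_value (Q j (initial b j)) i = coded_value (q (initial b k)) i"
      using settled_value[OF settled initial_nodes[OF b] i q'(1) q] by simp
  qed
qed

text \<open>At stage \<open>Suc k + j\<close> the node \<open>initial z j\<close> holds a witness
  for an edge through the points at \<open>s k @ [i] @ initial z j\<close>. As \<open>j\<close>
  grows, the witnesses converge by \<open>branch_limit\<close> with \<open>p = Suc k\<close>, and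
  the points converge by \<open>branch_limit\<close> with \<open>p = 0\<close>.\<close>

lemma edge:
  assumes z: "\<forall>i. z i < n"
  shows "\<exists>y. fst (F k y) = enat (m k) \<and>
    (\<forall>i<m k. snd (F k y) i = pt (branch_limit 0 (cat (s k @ [i]) z)))"
proof -
  let ?Q = "\<lambda>j. Q (Suc k + j)"
  have lim: "(\<lambda>j. edg (?Q j (initial z j))) \<longlonglongrightarrow> edg (branch_limit (Suc k) z)"
    by (rule tendsto_snd[OF tendsto_snd[OF branch_limit(1)[OF z]]])
  have "(\<lambda>t. ?Q j (t @ initial z j)) \<in> amalgams n (F k) (m k) (s k) (S k)" for j
    using S_suffix[OF Q[of "Suc k + j"] set_initial[OF z, of j]] S_Suc[of k] by auto
  then have e: "fst (F k (edg (?Q j (initial z j)))) = enat (m k)"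
    "i < m k \<Longrightarrow> snd (F k (edg (?Q j (initial z j)))) i = pt (?Q j ((s k @ [i]) @ initial z j))" for i j
    by (simp_all add: amalgams_def)
  show ?thesis
  proof (intro exI[of _ "edg (branch_limit (Suc k) z)"] conjI allI impI)
    show "fst (F k (edg (branch_limit (Suc k) z))) = enat (m k)"
      by (rule seq_space_limit(1)[OF F lim]) (rule e(1))
    fix i assume i: "i < m k"
    have "(\<lambda>j. snd (F k (edg (?Q j (initial z j)))) i) \<longlonglongrightarrow> snd (F k (edg (branch_limit (Suc k) z))) i"
      by (rule seq_space_limit(2)[OF F lim, of k "enat (m k)"]) (rule e(1), simp add: i)
    moreover have "(\<lambda>j. snd (F k (edg (?Q j (initial z j)))) i)
        \<longlonglongrightarrow> pt (branch_limit 0 (cat (s k @ [i]) z))"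
    proof -
      have len: "length (s k @ [i]) = Suc k" using s[of k] by (simp add: nodes_def)
      have "\<forall>j. cat (s k @ [i]) z j < n"
      proof
        fix j
        have "set (s k @ [i]) \<subseteq> {..<n}" using s[of k] i m[of k] by (auto simp: nodes_def)
        then have "(s k @ [i]) ! j < n" if "j < length (s k @ [i])"
          using nth_mem[OF that] by blast
        then show "cat (s k @ [i]) z j < n" using z by (simp add: cat_def)
      qed
      from LIMSEQ_ignore_initial_segment[OF tendsto_fst[OF branch_limit(1)[OF this, of 0]], of "Suc k"]
      have "(\<lambda>j. pt (?Q j (initial (cat (s k @ [i]) z) (Suc k + j))))
          \<longlonglongrightarrow> pt (branch_limit 0 (cat (s k @ [i]) z))"
        by (simp add: add.commute)
      moreover have "initial (cat (s k @ [i]) z) (Suc k + j) = (s k @ [i]) @ initial z j" for j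
        using initial_cat[of "s k @ [i]" z j] unfolding len .
      ultimately show ?thesis by (simp only: e(2)[OF i])
    qed
    ultimately show "snd (F k (edg (branch_limit (Suc k) z))) i = pt (branch_limit 0 (cat (s k @ [i]) z))"
      by (rule LIMSEQ_unique)
  qed
qed

section \<open>The tree of values\<close>

definition value_tree :: "nat list set" where
  "value_tree = {initial (coded_value (branch_limit 0 b)) k | b k. \<forall>i. b i < n}"

lemma omega_tree_value_tree: "omega_tree value_tree"
  unfolding omega_tree_def
proof (intro ballI allI impI)
  fix t u assume "t \<in> value_tree" "prefix u t"
  then obtain b k where b: "\<forall>i. b i < n" "t = initial (coded_value (branch_limit 0 b)) k"
    unfolding value_tree_def by blast
  have "u = take (length u) t" using \<open>prefix u t\<close> by (metis append_eq_conv_conj prefix_def)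
  moreover have "length u \<le> k" using prefix_length_le[OF \<open>prefix u t\<close>] b(2) by simp
  ultimately have "u = initial (coded_value (branch_limit 0 b)) (length u)"
    unfolding b(2) initial_def by (metis add_0 take_map take_upt)
  with b(1) show "u \<in> value_tree" unfolding value_tree_def by blast
qed

text \<open>Beyond \<open>l 0\<close>, choose \<open>k\<close> with
  \<open>l k \<le> length \<sigma> < l (Suc k)\<close>. Branches through \<open>\<sigma>\<close>
  agree below \<open>l k\<close>, so by \<open>settled_eq\<close> their nodes of level
  \<open>k\<close> have equal values in all of \<open>S k\<close>, in particular in the parts of
  \<open>Q (Suc k)\<close>. The next value is then determined by the next letter of the branch,
  which is less than \<open>n\<close>.\<close>

lemma branching_le_value_tree: "branching_le n value_tree"
  unfolding branching_le_def
proof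
  fix \<sigma>
  let ?J = "{j. \<sigma> @ [j] \<in> value_tree}"
  have J: "\<exists>b. (\<forall>i. b i < n) \<and> j = coded_value (branch_limit 0 b) (length \<sigma>) \<and>
      (\<forall>i<length \<sigma>. coded_value (branch_limit 0 b) i = \<sigma> ! i)" if "j \<in> ?J" for j
  proof -
    obtain b k where b: "\<forall>i. b i < n" "\<sigma> @ [j] = initial (coded_value (branch_limit 0 b)) k"
      using \<open>j \<in> ?J\<close> unfolding value_tree_def by blast
    have k: "k = Suc (length \<sigma>)" using arg_cong[OF b(2), of length] by simp
    have "\<sigma> = initial (coded_value (branch_limit 0 b)) (length \<sigma>)" "j = coded_value (branch_limit 0 b) (length \<sigma>)"
      using b(2) unfolding k initial_Suc by simp_all
    moreover have "initial f (length \<sigma>) ! i = f i" if "i < length \<sigma>" for f i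
      using that by (simp add: initial_def)
    ultimately show ?thesis using b(1) by metis
  qed
  have "\<exists>f. ?J \<subseteq> f ` {..<n}"
  proof (cases "length \<sigma> < l 0 \<or> ?J = {}")
    case True
    \<comment> \<open>Values below \<open>l 0\<close> are decided at the root, which leaves at most
      one successor; \<open>n \<ge> 1\<close> makes the index set nonempty.\<close>
    have "j = coded_value (Q 0 []) (length \<sigma>)" if "j \<in> ?J" for j
      using J[OF that] coded_value_branch_limit[OF _ Q[of 0], of _ "length \<sigma>"] True that by auto
    then have "?J \<subseteq> (\<lambda>_. coded_value (Q 0 []) (length \<sigma>)) ` {..<n}" using n by fastforce
    then show ?thesis by blast
  next
    case False
    have unbdd: "length \<sigma> < l (Suc (length \<sigma>))"
      using strict_mono_imp_increasing[OF strict_mono_l, of "Suc (length \<sigma>)"] by simp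
    define K where "K = (LEAST k. length \<sigma> < l k)"
    have K: "length \<sigma> < l K" unfolding K_def using unbdd by (rule LeastI)
    with False obtain k where k: "K = Suc k" by (cases K) auto
    have lk: "l k \<le> length \<sigma>"
      using not_less_Least[of k "\<lambda>k. length \<sigma> < l k"] k unfolding K_def by simp
    obtain b0 where b0: "\<forall>i. b0 i < n" "\<forall>i<length \<sigma>. coded_value (branch_limit 0 b0) i = \<sigma> ! i"
      using False J by blast
    \<comment> \<open>The node of one fixed branch through \<open>\<sigma>\<close> represents those
      of all the others.\<close>
    define t0 where "t0 = initial b0 k"
    have "j \<in> (\<lambda>i. coded_value (Q (Suc k) (t0 @ [i])) (length \<sigma>)) ` {..<n}" if j: "j \<in> ?J" for j
    proof -
      obtain b where b: "\<forall>i. b i < n" "j = coded_value (branch_limit 0 b) (length \<sigma>)"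
          "\<forall>i<length \<sigma>. coded_value (branch_limit 0 b) i = \<sigma> ! i"
        using J[OF j] by blast
      have eq: "coded_value (q (initial b k)) i = coded_value (q t0) i" if "q \<in> S k" "i < l k" for q i
        using coded_value_branch_limit[of b q k i] coded_value_branch_limit[of b0 q k i] that b b0 lk
        unfolding t0_def by simp
      have "restr (b k) (Q (Suc k)) \<in> S k"
        using Q[of "Suc k"] S_Suc[of k] b(1) by (auto simp: amalgams_def)
      moreover have "coded_value (q (initial b k)) = coded_value (q t0)" if "q \<in> S k" for q
      proof (rule settled_eq[OF settled _ _ _ that])
        show "initial b k \<in> nodes n k" using b(1) by (rule initial_nodes)
        show "t0 \<in> nodes n k" unfolding t0_def using b0(1) by (rule initial_nodes)
      qed (rule eq)
      ultimately have "coded_value (Q (Suc k) (initial b (Suc k))) = coded_value (Q (Suc k) (t0 @ [b k]))"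
        unfolding initial_Suc restr_def by blast
      then have "j = coded_value (Q (Suc k) (t0 @ [b k])) (length \<sigma>)"
        using coded_value_branch_limit[of b "Q (Suc k)" "Suc k" "length \<sigma>"] b(1,2) Q K k by simp
      then show ?thesis using b(1) by blast
    qed
    then show ?thesis by blast
  qed
  then obtain f where f: "?J \<subseteq> f ` {..<n}" ..
  then have "finite ?J" by (rule finite_subset) simp
  moreover have "card ?J \<le> n"
    using card_mono[OF _ f] card_image_le[of "{..<n}" f] by simp
  ultimately show "finite ?J \<and> card ?J \<le> n" ..
qed

end

section \<open>Continuity and largeness of the limit copy\<close>

context fusion
begin

lemma branch_limit_cong:
  assumes b: "\<forall>i. b i < n" "\<forall>i. b' i < n" and eq: "\<And>i. i < Suc k \<Longrightarrow> b i = b' i"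
  shows "dist (branch_limit 0 b) (branch_limit 0 b') \<le> 2 * (1 / real (Suc k))"
proof -
  let ?q = "Q (Suc k) (initial b (Suc k))"
  have "dist ?q (branch_limit 0 b) \<le> 1 / real (Suc k)"
    using branch_limit(2)[OF b(1), of "Q (Suc k)" 0 k] Q[of "Suc k"] by simp
  moreover have "dist ?q (branch_limit 0 b') \<le> 1 / real (Suc k)"
    using branch_limit(2)[OF b(2), of "Q (Suc k)" 0 k] Q[of "Suc k"] initial_eqI[OF eq, of "Suc k"] by simp
  ultimately show ?thesis
    using dist_triangle3[of "branch_limit 0 b" "branch_limit 0 b'" ?q] by simp
qed

text \<open>Reduction modulo \<open>n\<close> extends the map from branches with letters below
  \<open>n\<close> to all of Baire space, a Polish type on which the category theorem is
  available.\<close>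

definition proj :: "(nat \<Rightarrow> nat) \<Rightarrow> 'a" where
  "proj b = pt (branch_limit 0 (\<lambda>i. b i mod n))"

lemma mod_less: "\<forall>i. (b i :: nat) mod n < n"
  using n by simp

lemma continuous_proj: "continuous_on UNIV proj"
  unfolding continuous_on_open_vimage[OF open_UNIV]
proof (intro allI impI)
  fix U :: "'a set" assume U: "open U"
  have "\<exists>k. \<forall>b'. (\<forall>i<k. b' i = b i) \<longrightarrow> b' \<in> proj -` U" if b: "b \<in> proj -` U" for b
  proof -
    obtain e where e: "e > 0" "ball (proj b) e \<subseteq> U"
      using U b unfolding open_contains_ball by blast
    obtain k where k: "1 / real (Suc k) < e / 2"
      using nat_approx_posE[of "e / 2"] e(1) by auto
    have "b' \<in> proj -` U" if "\<forall>i<Suc k. b' i = b i" for b'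
    proof -
      have "dist (branch_limit 0 (\<lambda>i. b i mod n)) (branch_limit 0 (\<lambda>i. b' i mod n)) \<le> 2 * (1 / real (Suc k))"
        by (rule branch_limit_cong[OF mod_less mod_less]) (simp add: that)
      then have "dist (proj b) (proj b') < e"
        using dist_fst_le[of "branch_limit 0 (\<lambda>i. b i mod n)" "branch_limit 0 (\<lambda>i. b' i mod n)"] k
        unfolding proj_def by linarith
      then show ?thesis using e(2) by auto
    qed
    then show ?thesis by blast
  qed
  then show "open (proj -` U \<inter> UNIV)" by (simp add: open_nat_fun_iff)
qed

text \<open>The edges at the sequences \<open>s k\<close> make every anticlique meager in the final copy of
  \<open>n\<^sup>\<omega>\<close>, as in the easy direction of the \<open>G\<^sub>0\<close>-dichotomy.\<close>

lemma range_proj_not_in_ideal: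
  assumes dense: "\<And>G u k. G \<in> \<G> \<Longrightarrow> (0, \<lambda>_. undefined) \<notin> G \<Longrightarrow> u \<in> nodes n k \<Longrightarrow>
      \<exists>k r. s k = u @ r \<and> range (F k) = G"
  shows "range proj \<notin> hypergraph_ideal \<G>"
proof
  assume "range proj \<in> hypergraph_ideal \<G>"
  then obtain \<C> where \<C>: "\<C> \<subseteq> {B \<in> sets borel. \<exists>G\<in>\<G>. anticlique G B}" "countable \<C>"
      "range proj \<subseteq> \<Union>\<C>"
    unfolding hypergraph_ideal_def by (rule sigma_ideal_generatedE)
  have "\<exists>B\<in>\<C>. \<not> meager (proj -` B)"
  proof (rule ccontr)
    assume "\<not> ?thesis"
    then have "meager (\<Union>B\<in>\<C>. proj -` B)" using \<C>(2) by (intro meager_UN) auto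
    moreover have "(\<Union>B\<in>\<C>. proj -` B) = UNIV" using \<C>(3) by auto
    ultimately show False using not_meager_UNIV by metis
  qed
  then obtain B G where B: "B \<in> sets borel" "G \<in> \<G>" "anticlique G B" "\<not> meager (proj -` B)"
    using \<C>(1) by blast
  \<comment> \<open>The empty sequence belongs to \<open>seqs B\<close> for every \<open>B\<close>,
    so a hypergraph containing it has no anticliques. Hence \<open>dense\<close> applies to
    \<open>G\<close>.\<close>
  have G: "(0, \<lambda>_. undefined) \<notin> G"
  proof
    assume "(0, \<lambda>_. undefined) \<in> G"
    moreover have "(0, \<lambda>_. undefined) \<in> seqs B" by (simp add: seqs_def)
    ultimately show False using B(3) by (auto simp: anticlique_def)
  qed
  have "proj -` B \<in> sets borel"
    using measurable_sets_borel[OF borel_measurable_continuous_onI[OF continuous_proj] B(1)] .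
  then obtain U where U: "open U" "meager (U - proj -` B)" "meager (proj -` B - U)"
    by (rule borel_baire_property)
  have "U \<noteq> {}" using U(3) B(4) by auto
  then obtain b k0 where b: "b \<in> U" "\<And>b'. \<forall>i<k0. b' i = b i \<Longrightarrow> b' \<in> U"
    using U(1) unfolding open_nat_fun_iff by blast
  define u where "u = initial (\<lambda>i. b i mod n) k0"
  have "u \<in> nodes n k0" unfolding u_def by (rule initial_nodes[OF mod_less])
  then obtain k r where k: "s k = u @ r" "range (F k) = G"
    using dense[OF B(2) G] by blast
  \<comment> \<open>The prefix \<open>initial b k0\<close> is left unreduced, which keeps the branch
    in \<open>U\<close>. Reduction modulo \<open>n\<close> turns it into \<open>u\<close>, so for
    \<open>i < n\<close> the whole prefix becomes \<open>s k @ [i]\<close>.\<close>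
  define \<phi> where "\<phi> i = cat (initial b k0 @ r @ [i])" for i
  have "meager (\<phi> i -` (U - proj -` B))" for i
    unfolding \<phi>_def by (rule meager_vimage[OF U(2) continuous_on_cat open_cat])
  then have "meager (\<Union>i. \<phi> i -` (U - proj -` B))" by (intro meager_UN) auto
  \<comment> \<open>One tail \<open>z\<close> avoids the exceptional set for all \<open>i\<close> at
    once, so the edge over this tail has all its vertices in \<open>B\<close>.\<close>
  then obtain z where z: "\<And>i. \<phi> i z \<notin> U - proj -` B"
  proof -
    have "(\<Union>i. \<phi> i -` (U - proj -` B)) \<noteq> UNIV"
      using \<open>meager (\<Union>i. \<phi> i -` (U - proj -` B))\<close> not_meager_UNIV by metis
    then obtain z where "z \<notin> (\<Union>i. \<phi> i -` (U - proj -` B))" by blast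
    then show ?thesis by (intro that[of z]) blast
  qed
  have \<phi>_proj: "proj (\<phi> i z) \<in> B" for i
  proof -
    have "\<phi> i z \<in> U" by (rule b(2)) (simp add: \<phi>_def cat_def nth_append initial_def)
    then show ?thesis using z[of i] by simp
  qed
  obtain y where y: "fst (F k y) = enat (m k)"
      "\<And>i. i < m k \<Longrightarrow> snd (F k y) i = pt (branch_limit 0 (cat (s k @ [i]) (\<lambda>i. z i mod n)))"
    using edge[OF mod_less, of k z] by auto
  have "snd (F k y) i \<in> B" if i: "i < m k" for i
  proof -
    have "set r \<subseteq> {..<n}" using s[of k] k(1) by (simp add: nodes_def)
    then have r: "r ! j < n" if "j < length r" for j using nth_mem[OF that] by blast
    have "(\<lambda>j. \<phi> i z j mod n) = cat (s k @ [i]) (\<lambda>i. z i mod n)"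
    proof
      fix j
      consider "j < k0" | "k0 \<le> j" "j < k0 + length r" | "j = k0 + length r" | "j > k0 + length r"
        by linarith
      then show "\<phi> i z j mod n = cat (s k @ [i]) (\<lambda>i. z i mod n) j"
        using r[of "j - k0"] i m[of k]
        by cases (auto simp: \<phi>_def cat_def k(1) u_def nth_append initial_def)
    qed
    then show ?thesis using \<phi>_proj[of i] y(2)[OF i] by (simp add: proj_def)
  qed
  with seq_space_range[OF F, of k y] y(1) have "F k y \<in> seqs B"
    by (cases "F k y") (auto simp: seqs_def PiE_iff)
  then show False using B(3) k(2) by (auto simp: anticlique_def)
qed

end

lemma fusion_exists:
  fixes C :: "('a::polish_space \<times> (nat \<Rightarrow> nat)) set"
  assumes n: "n \<ge> 1" and C: "closed C" "fst ` C \<notin> hypergraph_ideal \<G>"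
    and F: "\<And>k. continuous_map euclidean seq_space (F k)" "\<And>k. range (F k) \<in> \<G>"
      "\<And>k. arity_le n (range (F k))" "\<And>k y. fst (F k y) \<noteq> 0"
    and s: "\<And>k. s k \<in> nodes n k"
  obtains S l m where "fusion n C F s S l m"
proof -
  define P where "P k x \<longleftrightarrow> (case x of (S, l, m) \<Rightarrow> closed S \<and> \<not> null_configs \<G> n k S \<and> settled n k l S \<and>
      m \<le> n \<and> (k = 0 \<longrightarrow> (\<forall>q\<in>S. (pt (q []), wit (q [])) \<in> C)))"
    for k and x :: "'a config set \<times> nat \<times> nat"
  define R where "R k x x' \<longleftrightarrow> (case x of (S, l, m) \<Rightarrow> case x' of (S', l', m') \<Rightarrow>
      S' \<subseteq> amalgams n (F k) m' (s k) S \<and> l < l')"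
    for k and x x' :: "'a config set \<times> nat \<times> nat"
  have "\<exists>f. \<forall>k. P k (f k) \<and> R k (f k) (f (Suc k))"
  proof (rule dependent_nat_choice)
    define S where "S = {q :: 'a config. (pt (q []), wit (q [])) \<in> C}"
    have S: "closed S"
      unfolding closed_sequential_limits
    proof (intro allI impI, elim conjE)
      fix q l assume q: "\<forall>k. q k \<in> S" and lim: "q \<longlonglongrightarrow> l"
      note lim' = tendsto_fun_coordinate[OF lim, of "[]"]
      have "(pt (l []), wit (l [])) \<in> C"
        by (rule closed_sequentially[OF C(1) _ tendsto_Pair[OF tendsto_fst[OF lim'] tendsto_fst[OF tendsto_snd[OF lim']]]])
          (use q in \<open>simp add: S_def\<close>)
      then show "l \<in> S" by (simp add: S_def)
    qed
    moreover have "\<not> null_configs \<G> n 0 S"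
    proof
      assume "null_configs \<G> n 0 S"
      then obtain N where N: "N \<in> hypergraph_ideal \<G>" "\<forall>q\<in>S. pt (q []) \<in> N"
        unfolding null_configs_def nodes_0 by blast
      have "fst ` C \<subseteq> N"
      proof
        fix x assume "x \<in> fst ` C"
        then obtain y where "(x, y) \<in> C" by auto
        then have "(\<lambda>_. (x, y, y)) \<in> S" by (simp add: S_def)
        with N(2) show "x \<in> N" by fastforce
      qed
      with N(1) C(2) show False using hypergraph_ideal_subset by blast
    qed
    ultimately obtain S' l where "S' \<subseteq> S" "closed S'" "\<not> null_configs \<G> n 0 S'" "l \<ge> 0" "settled n 0 l S'"
      by (rule settle)
    then have "P 0 (S', l, 0)" by (auto simp: P_def S_def)
    then show "\<exists>x. P 0 x" ..
  next
    fix x k assume "P k x"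
    then obtain S l m where x: "x = (S, l, m)" and S: "closed S" "\<not> null_configs \<G> n k S"
      by (cases x) (auto simp: P_def)
    obtain m' where m': "m' \<le> n" "\<not> null_configs \<G> n (Suc k) (amalgams n (F k) m' (s k) S)"
      by (rule amalgams_not_null[OF F(1,2,3,4) s S])
    obtain S' l' where S': "S' \<subseteq> amalgams n (F k) m' (s k) S" "closed S'"
        "\<not> null_configs \<G> n (Suc k) S'" "l' \<ge> Suc l" "settled n (Suc k) l' S'"
      by (rule settle[OF closed_amalgams[OF F(1) S(1)] m'(2)])
    have "P (Suc k) (S', l', m')" "R k x (S', l', m')"
      using S' m'(1) by (simp_all add: P_def R_def x)
    then show "\<exists>y. P (Suc k) y \<and> R k x y" by blast
  qed
  then obtain f where f: "\<And>k. P k (f k)" "\<And>k. R k (f k) (f (Suc k))" by blast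
  define S where "S k = fst (f k)" for k
  define l where "l k = fst (snd (f k))" for k
  \<comment> \<open>The length chosen in passing from stage \<open>k\<close> to \<open>Suc k\<close>
    is recorded with stage \<open>Suc k\<close>, hence the shift; the length recorded with stage 0
    is a placeholder.\<close>
  define m where "m k = snd (snd (f (Suc k)))" for k
  have f_eq: "f k = (S k, l k, snd (snd (f k)))" for k by (simp add: S_def l_def)
  have P: "closed (S k)" "\<not> null_configs \<G> n k (S k)" "settled n k (l k) (S k)" "m k \<le> n"
      "k = 0 \<Longrightarrow> \<forall>q\<in>S k. (pt (q []), wit (q [])) \<in> C" for k
    using f(1)[of k] f(1)[of "Suc k"] unfolding P_def S_def l_def m_def by (auto simp: case_prod_unfold)
  have R: "S (Suc k) \<subseteq> amalgams n (F k) (m k) (s k) (S k)" "l k < l (Suc k)" for k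
    using f(2)[of k] unfolding R_def S_def l_def m_def by (auto simp: case_prod_unfold)
  have "fusion n C F s S l m"
  proof
    show "S k \<noteq> {}" for k
      using P(2)[of k] hypergraph_ideal_empty[of \<G>] unfolding null_configs_def by auto
  qed (use n C(1) F(1) s P R in auto)
  then show thesis by (rule that)
qed

section \<open>Localization for Borel relations\<close>

lemma analytic_in_seq_space_range:
  assumes "analytic_in seq_space G" "G \<noteq> {}"
  obtains F where "continuous_map (euclidean :: (nat \<Rightarrow> nat) topology) seq_space F" "range F = G"
  using assms unfolding analytic_in_def by auto

lemma empty_seq_in_seqs: "(0, \<lambda>_. undefined) \<in> seqs B"
  by (simp add: seqs_def)

text \<open>Every pair \<open>(G, u)\<close> is listed at infinitely many indices; at index
  \<open>k\<close> its node is truncated or padded with 0 to have length \<open>k\<close>.\<close>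

lemma dense_node_sequence:
  assumes n: "n \<ge> (1 :: nat)" and A: "countable A" "A \<noteq> {}"
  obtains s :: "nat \<Rightarrow> nat list" and g :: "nat \<Rightarrow> 'b" where
    "\<And>k. s k \<in> nodes n k" "\<And>k. g k \<in> A"
    "\<And>G u k. G \<in> A \<Longrightarrow> u \<in> nodes n k \<Longrightarrow> \<exists>k r. s k = u @ r \<and> g k = G"
proof -
  let ?P = "A \<times> {u. set u \<subseteq> {..<n}}"
  define e where "e = from_nat_into ?P"
  have P: "countable ?P" using A(1) by (intro countable_SIGMA) auto
  have "[] \<in> {u. set u \<subseteq> {..<n}}" by simp
  with A(2) have ne: "?P \<noteq> {}" by blast
  have e: "e k \<in> ?P" for k unfolding e_def using ne by (rule from_nat_into)
  define s where "s k = take k (snd (e (fst (prod_decode k))) @ replicate k 0)" for k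
  define g where "g k = fst (e (fst (prod_decode k)))" for k
  show thesis
  proof (rule that)
    show "s k \<in> nodes n k" for k
    proof -
      have "set (snd (e (fst (prod_decode k))) @ replicate k 0) \<subseteq> {..<n}"
        using e[of "fst (prod_decode k)"] n by auto
      then have "set (s k) \<subseteq> {..<n}" unfolding s_def by (meson order_trans set_take_subset)
      then show ?thesis by (simp add: nodes_def s_def)
    qed
    show "g k \<in> A" for k using e[of "fst (prod_decode k)"] by (auto simp: g_def)
    fix G u k assume "G \<in> A" "u \<in> nodes n k"
    then have "(G, u) \<in> ?P" by (simp add: nodes_def)
    from from_nat_into_surj[OF P this] obtain a where a: "e a = (G, u)" unfolding e_def ..
    \<comment> \<open>This index codes the pair and is at least \<open>length u\<close>, so
      \<open>u\<close> is padded and not truncated.\<close>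
    let ?k = "prod_encode (a, length u)"
    have "length u \<le> ?k" by (rule le_prod_encode_2)
    then have "s ?k = u @ take (?k - length u) (replicate ?k 0)"
      by (simp add: s_def a)
    moreover have "g ?k = G" by (simp add: g_def a)
    ultimately show "\<exists>k r. s k = u @ r \<and> g k = G" by blast
  qed
qed

lemma initial_tree:
  "omega_tree {initial f k | k. True}" "n \<ge> 1 \<Longrightarrow> branching_le n {initial f k | k. True}"
proof -
  show "omega_tree {initial f k | k. True}"
    unfolding omega_tree_def
  proof (intro ballI allI impI)
    fix t u assume "t \<in> {initial f k | k. True}" "prefix u t"
    then obtain k where k: "t = initial f k" by blast
    have "u = take (length u) t" using \<open>prefix u t\<close> by (metis append_eq_conv_conj prefix_def)
    moreover have "length u \<le> k" using prefix_length_le[OF \<open>prefix u t\<close>] k by simp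
    ultimately have "u = initial f (length u)"
      unfolding k initial_def by (metis add_0 take_map take_upt)
    then show "u \<in> {initial f k | k. True}" by blast
  qed
  assume n: "n \<ge> 1"
  show "branching_le n {initial f k | k. True}"
    unfolding branching_le_def
  proof
    fix \<sigma>
    have "j = f (length \<sigma>)" if j: "\<sigma> @ [j] \<in> {initial f k | k. True}" for j
    proof -
      obtain k where k: "\<sigma> @ [j] = initial f k" using j by blast
      have "k = Suc (length \<sigma>)" using arg_cong[OF k, of length] by simp
      with k show ?thesis by (simp add: initial_Suc)
    qed
    then have sub: "{j. \<sigma> @ [j] \<in> {initial f k | k. True}} \<subseteq> {f (length \<sigma>)}" by blast
    have "card {j. \<sigma> @ [j] \<in> {initial f k | k. True}} \<le> card {f (length \<sigma>)}"
      by (rule card_mono[OF _ sub]) simp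
    with n finite_subset[OF sub] show "finite {j. \<sigma> @ [j] \<in> {initial f k | k. True}} \<and>
        card {j. \<sigma> @ [j] \<in> {initial f k | k. True}} \<le> n" by simp
  qed
qed

text \<open>The sequence \<open>t\<close> may depend on the level \<open>k\<close>. So only
  countable unions and intersections of the sets \<open>E i j\<close> occur, and the form matches
  that of \<open>forces_branch\<close>.\<close>

definition in_tree_set :: "(nat \<Rightarrow> nat \<Rightarrow> 'a set) \<Rightarrow> nat list set \<Rightarrow> 'a set" where
  "in_tree_set E T = {x. \<forall>k. \<exists>t\<in>T. length t = k \<and> (\<forall>i<k. x \<in> E i (t ! i))}"

theorem localization_of_borel_relation:
  fixes E :: "nat \<Rightarrow> nat \<Rightarrow> 'a::polish_space set"
  assumes n: "n \<ge> 1" and \<G>: "countable \<G>" "\<And>G. G \<in> \<G> \<Longrightarrow> analytic_in seq_space G"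
      "\<And>G. G \<in> \<G> \<Longrightarrow> arity_le n G"
    and E: "\<And>k j. E k j \<in> sets borel" "{x. \<forall>k. \<exists>j. x \<in> E k j} \<notin> hypergraph_ideal \<G>"
  obtains T where "omega_tree T" "branching_le n T" "in_tree_set E T \<notin> hypergraph_ideal \<G>"
proof (cases "\<exists>G\<in>\<G>. (0, \<lambda>_. undefined) \<notin> G")
  case False
  \<comment> \<open>Here no set is an anticlique, so every nonempty set is positive and the tree
    given by the values of a single point suffices.\<close>
  have "{x. \<forall>k. \<exists>j. x \<in> E k j} \<noteq> {}"
    using E(2) hypergraph_ideal_empty[of \<G>] by metis
  then obtain x where "\<forall>k. \<exists>j. x \<in> E k j" by blast
  from choice[OF this] obtain f where f: "\<forall>k. x \<in> E k (f k)" ..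
  let ?T = "{initial f k | k. True}"
  have x: "x \<in> in_tree_set E ?T"
    unfolding in_tree_set_def mem_Collect_eq
  proof
    fix k
    show "\<exists>t\<in>?T. length t = k \<and> (\<forall>i<k. x \<in> E i (t ! i))"
      using f by (intro bexI[of _ "initial f k"]) (auto simp: initial_def)
  qed
  have "in_tree_set E ?T \<notin> hypergraph_ideal \<G>"
  proof
    assume "in_tree_set E ?T \<in> hypergraph_ideal \<G>"
    then obtain \<C> where \<C>: "\<C> \<subseteq> {B \<in> sets borel. \<exists>G\<in>\<G>. anticlique G B}" "in_tree_set E ?T \<subseteq> \<Union>\<C>"
      unfolding hypergraph_ideal_def by (rule sigma_ideal_generatedE)
    then obtain B G where "G \<in> \<G>" "anticlique G B" using x by blast
    then show False using False empty_seq_in_seqs[of B] by (auto simp: anticlique_def)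
  qed
  with initial_tree(1) initial_tree(2)[OF n] show thesis by (rule that)
next
  case True
  let ?\<H> = "{G \<in> \<G>. (0, \<lambda>_. undefined) \<notin> G}"
  \<comment> \<open>For the empty hypergraph the whole space would be an anticlique. Nonemptiness
    gives each analytic hypergraph a continuous parametrization.\<close>
  have "{} \<notin> \<G>"
  proof
    assume "{} \<in> \<G>"
    then have "UNIV \<in> hypergraph_ideal \<G>"
      by (intro anticlique_in_hypergraph_ideal[of UNIV "{}"]) (simp_all add: anticlique_def)
    then show False using E(2) hypergraph_ideal_subset by blast
  qed
  then have "\<forall>G\<in>\<G>. \<exists>F. continuous_map (euclidean :: (nat \<Rightarrow> nat) topology) seq_space F \<and> range F = G"
    using \<G>(2) by (metis analytic_in_seq_space_range)
  from bchoice[OF this] obtain \<F> where \<F>: "\<forall>G\<in>\<G>.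
      continuous_map (euclidean :: (nat \<Rightarrow> nat) topology) seq_space (\<F> G) \<and> range (\<F> G) = G" ..
  have "countable ?\<H>" using \<G>(1) by (rule countable_subset[rotated]) blast
  moreover have "?\<H> \<noteq> {}" using True by blast
  ultimately obtain s g where sg: "\<And>k. s k \<in> nodes n k" "\<And>k. g k \<in> ?\<H>"
      "\<And>G u k. G \<in> ?\<H> \<Longrightarrow> u \<in> nodes n k \<Longrightarrow> \<exists>k r. s k = u @ r \<and> g k = G"
    by (rule dense_node_sequence[OF n]) blast
  define F where "F k = \<F> (g k)" for k
  have F_range: "continuous_map euclidean seq_space (F k)" "range (F k) = g k" for k
    using \<F> sg(2)[of k] by (simp_all add: F_def)
  have F0: "fst (F k y) \<noteq> 0" for k y
  proof
    assume "fst (F k y) = 0"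
    then have "F k y = (0, \<lambda>_. undefined)"
      using seq_space_range[OF F_range(1), of k y] by (cases "F k y") (auto simp: seqs_def)
    then show False using F_range(2)[of k] sg(2)[of k] rangeI[of "F k" y] by auto
  qed
  obtain C where C_E: "closed C" "\<And>x y k. (x, y) \<in> C \<Longrightarrow> x \<in> E k (y (prod_encode (k, 0)))"
      "fst ` C = {x. \<forall>k. \<exists>j. x \<in> E k j}"
    by (rule closed_projection_scheme[of E]) (auto intro: borel_closed_projection E(1))
  obtain S l m where "fusion n C F s S l m"
  proof (rule fusion_exists[OF n C_E(1) _ F_range(1) _ _ F0 sg(1)])
    show "fst ` C \<notin> hypergraph_ideal \<G>" unfolding C_E(3) by (rule E(2))
    show "range (F k) \<in> \<G>" "arity_le n (range (F k))" for k
      using F_range(2) sg(2)[of k] \<G>(3) by auto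
  qed
  then interpret fusion n C F s S l m .
  have "range proj \<notin> hypergraph_ideal \<G>"
  proof (rule range_proj_not_in_ideal)
    fix G u k assume "G \<in> \<G>" "(0, \<lambda>_. undefined) \<notin> G" "u \<in> nodes n k"
    then show "\<exists>k r. s k = u @ r \<and> range (F k) = G" using sg(3)[of G u k] F_range(2) by auto
  qed
  moreover have "range proj \<subseteq> in_tree_set E value_tree"
  proof
    fix x assume "x \<in> range proj"
    then obtain b where b: "x = pt (branch_limit 0 (\<lambda>i. b i mod n))" by (auto simp: proj_def)
    let ?v = "branch_limit 0 (\<lambda>i. b i mod n)"
    have "x \<in> E k (coded_value ?v k)" for k
      using C_E(2)[OF branch_limit_in_C[OF mod_less]] by (simp add: b coded_value_def)
    moreover have "initial (coded_value ?v) k \<in> value_tree" for k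
      unfolding value_tree_def mem_Collect_eq using mod_less by (intro exI conjI) (rule refl)
    ultimately show "x \<in> in_tree_set E value_tree"
      unfolding in_tree_set_def mem_Collect_eq
      by (intro allI, rule_tac x = "initial (coded_value ?v) k" in bexI) (simp_all add: initial_def)
  qed
  ultimately have "in_tree_set E value_tree \<notin> hypergraph_ideal \<G>"
    using hypergraph_ideal_subset by blast
  with omega_tree_value_tree branching_le_value_tree show thesis by (rule that)
qed

section \<open>Countable elementary submodels\<close>

instance fm :: countable
  by countable_datatype

primrec var_bound :: "fm \<Rightarrow> nat" where
  "var_bound (FAtom i) = Suc i"
| "var_bound (FEq i j) = max (Suc i) (Suc j)"
| "var_bound (FMem i j) = max (Suc i) (Suc j)"
| "var_bound (FNeg \<phi>) = var_bound \<phi>"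
| "var_bound (FAnd \<phi> \<psi>) = max (var_bound \<phi>) (var_bound \<psi>)"
| "var_bound (FEx i \<phi>) = max (Suc i) (var_bound \<phi>)"

lemma sat_cong:
  "(\<And>i. i < var_bound \<phi> \<Longrightarrow> e i = e' i) \<Longrightarrow> sat M e \<phi> \<longleftrightarrow> sat M e' \<phi>"
proof (induction \<phi> arbitrary: e e')
  case (FNeg \<phi>)
  then show ?case by (metis sat.simps(4) var_bound.simps(4))
next
  case (FAnd \<phi> \<psi>)
  have "sat M e \<phi> \<longleftrightarrow> sat M e' \<phi>" by (rule FAnd.IH(1)) (simp add: FAnd.prems)
  moreover have "sat M e \<psi> \<longleftrightarrow> sat M e' \<psi>" by (rule FAnd.IH(2)) (simp add: FAnd.prems)
  ultimately show ?case by simp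
next
  case (FEx i \<phi>)
  have "sat M (e(i := x)) \<phi> \<longleftrightarrow> sat M (e'(i := x)) \<phi>" for x
    by (rule FEx.IH) (simp add: FEx.prems)
  then show ?case by simp
qed auto

definition list_assignment :: "'p hset \<Rightarrow> 'p hset list \<Rightarrow> nat \<Rightarrow> 'p hset" where
  "list_assignment c xs i = (if i < length xs then xs ! i else c)"

text \<open>Finite parameter lists in place of full assignments keep the set of values over a
  countable set countable.\<close>

definition skolem :: "'p hset \<Rightarrow> fm \<times> nat \<times> 'p hset list \<Rightarrow> 'p hset" where
  "skolem c = (\<lambda>(\<phi>, i, xs). SOME x. sat UNIV ((list_assignment c xs)(i := x)) \<phi>)"

primrec skolem_stage :: "'p hset \<Rightarrow> 'p hset set \<Rightarrow> nat \<Rightarrow> 'p hset set" where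
  "skolem_stage c A 0 = A"
| "skolem_stage c A (Suc k) =
     skolem_stage c A k \<union> skolem c ` (UNIV \<times> UNIV \<times> lists (skolem_stage c A k))"

lemma countable_skolem_stage: "countable A \<Longrightarrow> countable (skolem_stage c A k)"
  by (induction k) (simp_all add: countable_SIGMA)

lemma skolem_stage_mono: "j \<le> k \<Longrightarrow> skolem_stage c A j \<subseteq> skolem_stage c A k"
  by (rule lift_Suc_mono_le[of "skolem_stage c A"]) auto

lemma lists_skolem_stage:
  "xs \<in> lists (\<Union>k. skolem_stage c A k) \<Longrightarrow> \<exists>k. xs \<in> lists (skolem_stage c A k)"
proof (induction xs)
  case (Cons x xs)
  then obtain j k where "x \<in> skolem_stage c A j" "xs \<in> lists (skolem_stage c A k)" by auto
  then have "x \<in> skolem_stage c A (max j k)" "xs \<in> lists (skolem_stage c A (max j k))"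
    using skolem_stage_mono[of j "max j k" c A] lists_mono[OF skolem_stage_mono[of k "max j k" c A]]
    by auto
  then show ?case by (intro exI[of _ "max j k"]) simp
qed simp

text \<open>The Skolem hull contains witnesses for the existential formulas with parameters in it,
  which is the Tarski-Vaught criterion. The element \<open>c\<close> pads the parameter lists and
  makes the hull nonempty.\<close>

theorem lowenheim_skolem:
  fixes A :: "'p hset set"
  assumes "countable A"
  obtains M where "countable M" "elementary_submodel M" "A \<subseteq> M"
proof -
  fix c :: "'p hset"
  define M where "M = (\<Union>k. skolem_stage c (insert c A) k)"
  have stage: "skolem_stage c (insert c A) k \<subseteq> M" for k
    unfolding M_def by (rule UN_upper) simp
  from this[of 0] have c: "c \<in> M" and A: "A \<subseteq> M" by simp_all
  have closed: "skolem c (\<phi>, i, xs) \<in> M" if xs: "xs \<in> lists M" for \<phi> i xs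
  proof -
    from lists_skolem_stage[OF xs[unfolded M_def]]
    obtain k where "xs \<in> lists (skolem_stage c (insert c A) k)" ..
    then have "skolem c (\<phi>, i, xs) \<in> skolem_stage c (insert c A) (Suc k)" by simp
    with stage show ?thesis ..
  qed
  have sat: "sat M e \<phi> \<longleftrightarrow> sat UNIV e \<phi>" if "range e \<subseteq> M" for e \<phi>
    using that
  proof (induction \<phi> arbitrary: e)
    case (FEx i \<phi>)
    have range: "range (e(i := x)) \<subseteq> M" if "x \<in> M" for x
      using FEx.prems that by auto
    have "\<exists>x\<in>M. sat UNIV (e(i := x)) \<phi>" if ex: "\<exists>x. sat UNIV (e(i := x)) \<phi>"
    proof -
      let ?xs = "map e [0..<var_bound \<phi>]"
      have eq: "sat UNIV ((list_assignment c ?xs)(i := x)) \<phi> \<longleftrightarrow> sat UNIV (e(i := x)) \<phi>" for x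
        by (rule sat_cong) (simp add: list_assignment_def)
      have "sat UNIV ((list_assignment c ?xs)(i := skolem c (\<phi>, i, ?xs))) \<phi>"
        using ex unfolding skolem_def eq[symmetric] unfolding prod.case by (rule someI_ex)
      moreover have "skolem c (\<phi>, i, ?xs) \<in> M"
        by (rule closed) (use FEx.prems in \<open>auto simp: image_subset_iff\<close>)
      ultimately show ?thesis unfolding eq by blast
    qed
    moreover have "sat M (e(i := x)) \<phi> \<longleftrightarrow> sat UNIV (e(i := x)) \<phi>" if "x \<in> M" for x
      using range[OF that] by (rule FEx.IH)
    ultimately show ?case unfolding sat.simps by blast
  qed auto
  have "countable M"
    unfolding M_def using assms by (intro countable_UN countable_skolem_stage) auto
  moreover have "elementary_submodel M"
    unfolding elementary_submodel_def using c sat by blast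
  ultimately show thesis using A by (rule that)
qed

lemma inj_hatom: "inj hatom"
proof (rule injI)
  fix p q :: 'p assume "hatom p = hatom q"
  then have "heq (Atom p) (Atom q)" by (simp add: hatom.abs_eq hset.abs_eq_iff)
  then show "p = q" by cases auto
qed

section \<open>Forcing\<close>

lemma coordinates_borel:
  assumes "\<And>i j. E i j \<in> sets borel"
  shows "{x. \<forall>i<k. x \<in> E i (t ! i)} \<in> sets borel"
proof (induction k)
  case (Suc k)
  have "{x. \<forall>i<Suc k. x \<in> E i (t ! i)} = {x. \<forall>i<k. x \<in> E i (t ! i)} \<inter> E k (t ! k)"
    by (auto simp: less_Suc_eq)
  then show ?case using Suc assms by simp
qed simp

lemma in_tree_set_borel:
  assumes "\<And>i j. E i j \<in> sets borel"
  shows "in_tree_set E T \<in> sets borel"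
proof -
  have "in_tree_set E T = (\<Inter>k. \<Union>t\<in>{t \<in> T. length t = k}. {x. \<forall>i<k. x \<in> E i (t ! i)})"
    unfolding in_tree_set_def by blast
  moreover have "(\<Union>t\<in>{t \<in> T. length t = k}. {x. \<forall>i<k. x \<in> E i (t ! i)}) \<in> sets borel" for k
    by (intro sets.countable_UN'' coordinates_borel assms) simp
  then have "(\<Inter>k. \<Union>t\<in>{t \<in> T. length t = k}. {x. \<forall>i<k. x \<in> E i (t ! i)}) \<in> sets borel"
    by (rule sets.countable_INT[OF image_subsetI UNIV_not_empty])
  ultimately show ?thesis by (rule ssubst)
qed

lemma hypergraph_ideal_subset_UN:
  assumes "countable J" "A \<notin> hypergraph_ideal \<G>" "A \<subseteq> (\<Union>j\<in>J. B j)"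
  shows "\<exists>j\<in>J. A \<inter> B j \<notin> hypergraph_ideal \<G>"
proof (rule ccontr)
  assume "\<not> ?thesis"
  then have "(\<Union>j\<in>J. A \<inter> B j) \<in> hypergraph_ideal \<G>"
    using assms(1) by (intro hypergraph_ideal_UN) auto
  moreover have "A \<subseteq> (\<Union>j\<in>J. A \<inter> B j)" using assms(3) by blast
  ultimately show False using assms(2) hypergraph_ideal_subset by blast
qed

text \<open>\<open>E k j\<close> is the part of a master condition \<open>r\<close> covered by those
  countably many conditions of the model that force the value \<open>j\<close> at \<open>k\<close>.
  Genericity means that for each \<open>k\<close> these parts exhaust \<open>r\<close> up to a set
  in the ideal.\<close>

lemma proper_borel_reading:
  fixes \<G> :: "'a::polish_space hypergraph set"
  defines "P \<equiv> positive_borel (hypergraph_ideal \<G>)"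
  assumes proper: "proper_forcing P (\<subseteq>)" and p: "p \<in> P" and real: "forces_real P (\<subseteq>) p \<tau>"
    and q: "q \<in> P" "q \<subseteq> p"
  shows "\<exists>E. (\<forall>k j. E k j \<in> sets borel) \<and> (\<forall>k j. E k j \<subseteq> q) \<and>
    {x. \<forall>k. \<exists>j. x \<in> E k j} \<notin> hypergraph_ideal \<G> \<and>
    (\<forall>k j. \<forall>a\<in>P. a \<subseteq> E k j \<longrightarrow> forces_pair P (\<subseteq>) a \<tau> k j)"
proof -
  let ?I = "hypergraph_ideal \<G>"
  have P: "a \<in> P \<longleftrightarrow> a \<in> sets borel \<and> a \<notin> ?I" for a by (simp add: P_def positive_borel_def)
  \<comment> \<open>The conditions whose intersection with \<open>p\<close> is in the ideal are
    added to make \<open>D k\<close> dense in the whole poset and not only below \<open>p\<close>,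
    as \<open>master_condition\<close> demands.\<close>
  define D where "D k = {d \<in> P. d \<subseteq> p \<and> (\<exists>j. forces_pair P (\<subseteq>) d \<tau> k j) \<or> d \<in> P \<and> d \<inter> p \<in> ?I}" for k
  have D: "dense_in P (\<subseteq>) (D k)" for k
    unfolding dense_in_def
  proof (intro conjI ballI)
    show "D k \<subseteq> P" by (auto simp: D_def)
    fix a assume a: "a \<in> P"
    show "\<exists>d\<in>D k. d \<subseteq> a"
    proof (cases "a \<inter> p \<in> ?I")
      case True
      then show ?thesis using a by (intro bexI[of _ a]) (auto simp: D_def)
    next
      case False
      then have ap: "a \<inter> p \<in> P" using a p by (auto simp: P)
      have "dense_below P (\<subseteq>) p (\<lambda>r. \<exists>j. forces_pair P (\<subseteq>) r \<tau> k j)"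
        using real by (simp add: forces_real_def)
      from this[unfolded dense_below_def, rule_format, OF ap Int_lower2]
      obtain r where r: "r \<in> P" "r \<subseteq> a \<inter> p" "\<exists>j. forces_pair P (\<subseteq>) r \<tau> k j"
        by blast
      then have "r \<in> D k" unfolding D_def by simp
      with r(2) show ?thesis by blast
    qed
  qed
  have "countable (insert (poset_code P (\<subseteq>)) (insert (hatom q) (range (\<lambda>k. hcollect (hatom ` D k)))))"
    by simp
  then obtain M where M: "countable M" "elementary_submodel M"
      "insert (poset_code P (\<subseteq>)) (insert (hatom q) (range (\<lambda>k. hcollect (hatom ` D k)))) \<subseteq> M"
    by (rule lowenheim_skolem)
  obtain r where r: "r \<in> P" "r \<subseteq> q" "master_condition M P (\<subseteq>) r"
  proof -
    have "\<forall>p\<in>P. hatom p \<in> M \<longrightarrow> (\<exists>r\<in>P. r \<subseteq> p \<and> master_condition M P (\<subseteq>) r)"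
      using proper M unfolding proper_forcing_def by simp
    moreover have "hatom q \<in> M" using M(3) by simp
    ultimately have "\<exists>r\<in>P. r \<subseteq> q \<and> master_condition M P (\<subseteq>) r" using q(1) by blast
    then show ?thesis using that by blast
  qed
  define A where "A k j = {d \<in> D k. hatom d \<in> M \<and> d \<subseteq> p \<and> forces_pair P (\<subseteq>) d \<tau> k j}" for k j
  have countable_A: "countable (A k j)" for k j
  proof -
    have "hatom ` A k j \<subseteq> M" by (auto simp: A_def)
    then have "countable (hatom ` A k j)" using M(1) by (rule countable_subset)
    then show ?thesis by (rule countable_image_inj_on[OF _ inj_on_subset[OF inj_hatom subset_UNIV]])
  qed
  define E where "E k j = r \<inter> \<Union>(A k j)" for k j
  show ?thesis
  proof (intro exI[of _ E] conjI allI ballI impI)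
    show borel: "E k j \<in> sets borel" for k j
      unfolding E_def
      by (intro sets.Int sets.countable_Union[OF countable_A]) (use r(1) in \<open>auto simp: P A_def D_def\<close>)
    show "E k j \<subseteq> q" for k j using r(2) by (auto simp: E_def)
    \<comment> \<open>A positive remainder would contain a condition \<open>a\<close> below some
      \<open>d \<in> D k\<close> of the model. As \<open>a\<close> lies below \<open>p\<close>,
      \<open>d\<close> decides the value at \<open>k\<close> and belongs to some
      \<open>A k j\<close>, which leaves \<open>a\<close> empty.\<close>
    have N: "r - (\<Union>j. E k j) \<in> ?I" for k
    proof (rule ccontr)
      assume "r - (\<Union>j. E k j) \<notin> ?I"
      moreover have "r - (\<Union>j. E k j) \<in> sets borel"
        using r(1) borel by (intro sets.Diff sets.countable_UN) (auto simp: P)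
      ultimately have "r - (\<Union>j. E k j) \<in> P" by (simp add: P)
      moreover have "dense_below P (\<subseteq>) r (\<lambda>a. \<exists>d\<in>D k. hatom d \<in> M \<and> a \<subseteq> d)"
        using r(3) D[of k] M(3) unfolding master_condition_def by blast
      ultimately obtain a d where a: "a \<in> P" "a \<subseteq> r - (\<Union>j. E k j)" "d \<in> D k" "hatom d \<in> M" "a \<subseteq> d"
        unfolding dense_below_def by blast
      have "a \<subseteq> d \<inter> p" using a(2,5) r(2) q(2) by blast
      then have "d \<inter> p \<notin> ?I" using a(1) hypergraph_ideal_subset unfolding P by blast
      then obtain j where "d \<in> A k j" using a(3,4) by (auto simp: D_def A_def)
      then have "a = {}" using a(2,5) by (auto simp: E_def)
      then show False using a(1) hypergraph_ideal_empty[of \<G>] by (simp add: P)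
    qed
    show "{x. \<forall>k. \<exists>j. x \<in> E k j} \<notin> ?I"
    proof
      assume "{x. \<forall>k. \<exists>j. x \<in> E k j} \<in> ?I"
      moreover have "(\<Union>k. r - (\<Union>j. E k j)) \<in> ?I" using N by (intro hypergraph_ideal_UN) auto
      ultimately have "{x. \<forall>k. \<exists>j. x \<in> E k j} \<union> (\<Union>k. r - (\<Union>j. E k j)) \<in> ?I"
        by (rule hypergraph_ideal_Un)
      moreover have "r \<subseteq> {x. \<forall>k. \<exists>j. x \<in> E k j} \<union> (\<Union>k. r - (\<Union>j. E k j))" by blast
      ultimately have "r \<in> ?I" by (rule hypergraph_ideal_subset)
      then show False using r(1) by (simp add: P)
    qed
    fix k j a assume a: "a \<in> P" "a \<subseteq> E k j"
    show "forces_pair P (\<subseteq>) a \<tau> k j"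
      unfolding forces_pair_def dense_below_def
    proof (intro ballI impI)
      fix b assume b: "b \<in> P" "b \<subseteq> a"
      \<comment> \<open>\<open>b\<close> may fail to lie below a single member of
        \<open>A k j\<close>, but by countability it meets one of them in a positive set.\<close>
      have "b \<subseteq> (\<Union>d\<in>A k j. d)" using a(2) b(2) by (auto simp: E_def)
      then obtain d where d: "d \<in> A k j" "b \<inter> d \<notin> ?I"
        using hypergraph_ideal_subset_UN[OF countable_A, where A = b and B = "\<lambda>d. d"] b(1)
        unfolding P by blast
      then have "b \<inter> d \<in> P" using b(1) by (auto simp: P A_def D_def)
      then obtain c where "c \<in> P" "c \<subseteq> b \<inter> d" "\<exists>u\<in>\<tau> k j. c \<subseteq> u"
        using d(1) unfolding A_def forces_pair_def dense_below_def by blast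
      then show "\<exists>c\<in>P. c \<subseteq> b \<and> (\<exists>u\<in>\<tau> k j. c \<subseteq> u)" by blast
    qed
  qed
qed

theorem corollary3p7:
  fixes n :: nat and \<G> :: "'a::polish_space hypergraph set"
  assumes "n \<ge> 1"
    and "countable \<G>"
    and "\<And>G. G \<in> \<G> \<Longrightarrow> analytic_in seq_space G"
    and "\<And>G. G \<in> \<G> \<Longrightarrow> arity_le n G"
    and "proper_forcing (positive_borel (hypergraph_ideal \<G>)) (\<subseteq>)"
  shows "localization_property n (positive_borel (hypergraph_ideal \<G>)) (\<subseteq>)"
  unfolding localization_property_def
proof (intro allI impI ballI)
  let ?I = "hypergraph_ideal \<G>" and ?P = "positive_borel (hypergraph_ideal \<G>)"
  fix \<tau> p assume p: "p \<in> ?P" and real: "forces_real ?P (\<subseteq>) p \<tau>"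
  show "dense_below ?P (\<subseteq>) p (\<lambda>q. \<exists>T. omega_tree T \<and> branching_le n T \<and> forces_branch ?P (\<subseteq>) q \<tau> T)"
    unfolding dense_below_def
  proof (intro ballI impI)
    fix q assume q: "q \<in> ?P" "q \<subseteq> p"
    from proper_borel_reading[OF assms(5) p real q] obtain E where
      "(\<forall>k j. E k j \<in> sets borel) \<and> (\<forall>k j. E k j \<subseteq> q) \<and> {x. \<forall>k. \<exists>j. x \<in> E k j} \<notin> ?I \<and>
       (\<forall>k j. \<forall>a\<in>?P. a \<subseteq> E k j \<longrightarrow> forces_pair ?P (\<subseteq>) a \<tau> k j)" ..
    then have E: "\<And>k j. E k j \<in> sets borel" "\<And>k j. E k j \<subseteq> q"
        "{x. \<forall>k. \<exists>j. x \<in> E k j} \<notin> ?I"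
        "\<And>k j a. a \<in> ?P \<Longrightarrow> a \<subseteq> E k j \<Longrightarrow> forces_pair ?P (\<subseteq>) a \<tau> k j"
      by simp_all
    obtain T where T: "omega_tree T" "branching_le n T" "in_tree_set E T \<notin> ?I"
      by (rule localization_of_borel_relation[OF assms(1-4) E(1,3)])
    let ?R = "in_tree_set E T"
    have "?R \<in> ?P" using T(3) in_tree_set_borel[of E T] E(1) by (simp add: positive_borel_def)
    moreover have "?R \<subseteq> q"
    proof
      fix x assume "x \<in> ?R"
      \<comment> \<open>Level 0 carries no information; level 1 puts \<open>x\<close> into some
        \<open>E 0 j\<close>.\<close>
      then have "\<exists>t\<in>T. length t = Suc 0 \<and> (\<forall>i<Suc 0. x \<in> E i (t ! i))"
        unfolding in_tree_set_def by blast
      then obtain t where "x \<in> E 0 (t ! 0)" by blast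
      with E(2) show "x \<in> q" by blast
    qed
    moreover have "forces_branch ?P (\<subseteq>) ?R \<tau> T"
      unfolding forces_branch_def dense_below_def
    proof (intro allI ballI impI)
      fix k a assume a: "a \<in> ?P" "a \<subseteq> ?R"
      let ?T = "{t \<in> T. length t = k}"
      \<comment> \<open>The countably many nodes of level \<open>k\<close> cover \<open>a\<close> by
        pieces, and a positive piece forces its node to be an initial segment of the named
        function.\<close>
      have "a \<subseteq> (\<Union>t\<in>?T. {x. \<forall>i<k. x \<in> E i (t ! i)})"
        using a(2) unfolding in_tree_set_def by blast
      then obtain t where t: "t \<in> ?T" "a \<inter> {x. \<forall>i<k. x \<in> E i (t ! i)} \<notin> ?I"
        using hypergraph_ideal_subset_UN[of ?T a \<G> "\<lambda>t. {x. \<forall>i<k. x \<in> E i (t ! i)}"] a(1)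
        unfolding positive_borel_def by auto
      let ?b = "a \<inter> {x. \<forall>i<k. x \<in> E i (t ! i)}"
      have "a \<in> sets borel" using a(1) by (simp add: positive_borel_def)
      then have "?b \<in> sets borel" by (rule sets.Int[OF _ coordinates_borel[OF E(1)]])
      with t(2) have b: "?b \<in> ?P" by (simp add: positive_borel_def)
      have "forces_pair ?P (\<subseteq>) ?b \<tau> i (t ! i)" if "i < k" for i
        by (rule E(4)[OF b]) (use that in auto)
      with t(1) have "\<exists>s\<in>T. length s = k \<and> (\<forall>i<k. forces_pair ?P (\<subseteq>) ?b \<tau> i (s ! i))"
        by (intro bexI[of _ t]) auto
      with b show "\<exists>b\<in>?P. b \<subseteq> a \<and>
          (\<exists>s\<in>T. length s = k \<and> (\<forall>i<k. forces_pair ?P (\<subseteq>) b \<tau> i (s ! i)))"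
        by (intro bexI[of _ ?b] conjI Int_lower1)
    qed
    ultimately show "\<exists>r\<in>?P. r \<subseteq> q \<and> (\<exists>T. omega_tree T \<and> branching_le n T \<and> forces_branch ?P (\<subseteq>) r \<tau> T)"
      using T(1,2) by blast
  qed
qed

end
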